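(* Let $S$ be a cancellative left amenable monoid, let $K$ be a totally disconnected compact abelian group, and let $S \overset{\gamma}{\curvearrowright} K$ be a left action by continuous endomorphisms. Let $\widehat\gamma$ be the dual right action of $S$ on the (discrete) Pontryagin dual $\widehat K$ of $K$, given by $\widehat\gamma(s)=\widehat{\gamma(s)}$, i.e. $\widehat\gamma(s)(\chi)=\chi\circ\gamma(s)$. Then the topological entropy of $\gamma$ coincides with the algebraic entropy of $\widehat\gamma$: $$h_{top}(\gamma)=h^r_{alg}(\widehat\gamma).$$
   Context: A semigroup $S$ is cancellative if all left and right multiplications are injective. $S$ is left amenable if there is a finitely additive $\mu:\mathcal P(S)\to[0,1]$ with $\mu(S)=1$ and $\mu(L_s^{-1}(F))=\mu(F)$ for all $s\in S$, $F\subseteq S$, where $L_s(x)=sx$. A left Følner net of $S$ is a net $(F_i)_{i\in I}$ of non-empty finite subsets of $S$ with $\lim_{i\in I}|sF_i\setminus F_i|/|F_i|=0$ for every $s\in S$ (such nets exist when $S$ is cancellative left amenable). Left actions satisfy $\gamma(st)=\gamma(s)\gamma(t)$, right actions satisfy $\beta(st)=\beta(t)\beta(s)$, and for a monoid the identity element acts as the identity map. Topological entropy. Let $S$ act on the left on a compact space $C$ by continuous maps via $\gamma$. For open covers $\mathcal U,\mathcal V$ of $C$ let $\mathcal U\vee\mathcal V=\{U\cap V:U\in\mathcal U,V\in\mathcal V\}$, let $N(\mathcal U)$ be the minimal cardinality of a subcover of $\mathcal U$, and for non-empty finite $F\subseteq S$ let $\mathcal U_{\gamma,F}=\bigvee_{s\in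 F}\gamma(s)^{-1}(\mathcal U)$. Put $H_{top}(\gamma,\mathcal U)=\lim_{i\in I}\frac{\log N(\mathcal U_{\gamma,F_i})}{|F_i|}$ for any left Følner net $(F_i)_{i\in I}$ of $S$ (the limit is known to exist and not to depend on the net), and $h_{top}(\gamma)=\sup_{\mathcal U}H_{top}(\gamma,\mathcal U)$ over all open covers $\mathcal U$ of $C$. Algebraic entropy of a right action. Let $A\overset{\beta}{\curvearrowleft}S$ be a right action on an abelian group $A$ by endomorphisms. For non-empty finite $X\subseteq A$ and non-empty finite $F\subseteq S$ let $T_F(\beta,X)=\sum_{s\in F}\beta(s)(X)$ (sum of subsets), let $H^r_{alg}(\beta,X)=\lim_{i\in I}\frac{\log|T_{F_i}(\beta,X)|}{|F_i|}$ for any left Følner net $(F_i)_{i\in I}$ of $S$ (the limit is known to exist, be finite, and not depend on the net), and $h^r_{alg}(\beta)=\sup\{H^r_{alg}(\beta,X):X\subseteq A\text{ non-empty finite}\}$. (Equivalently, $h^r_{alg}(\beta)$ is the algebraic entropy of the corresponding left action of the opposite semigroup $S^{op}$, which is right amenable.) *)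

theory Defs
  imports "HOL-Analysis.Analysis" "HOL-Library.Set_Algebras"
begin

section \<open>Cancellative and left amenable semigroups\<close>

definition cancellative :: "'s::semigroup_mult itself \<Rightarrow> bool"
  where "cancellative _ \<longleftrightarrow>
    (\<forall>s::'s. inj (\<lambda>x. s * x)) \<and> (\<forall>s::'s. inj (\<lambda>x. x * s))"

definition left_amenable :: "'s::semigroup_mult itself \<Rightarrow> bool"
  where "left_amenable _ \<longleftrightarrow>
    (\<exists>\<mu> :: 's set \<Rightarrow> real.
       (\<forall>F. \<mu> F \<in> {0..1}) \<and> \<mu> UNIV = 1 \<and>
       (\<forall>E F. E \<inter> F = {} \<longrightarrow> \<mu> (E \<union> F) = \<mu> E + \<mu> F) \<and>
       (\<forall>s F. \<mu> ((\<lambda>x. s * x) -` F) = \<mu> F))"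


section \<open>Nets\<close>

text \<open>
  The index set of a net is a (nonempty) type with a directed preorder. The limit of a net is
  the limit along the filter generated by the tails of the index set. (The library's
  \<^const>\<open>at_top\<close> is this filter, but is only available for partial orders.)
\<close>

definition directed_type :: "'i::preorder itself \<Rightarrow> bool"
  where "directed_type _ \<longleftrightarrow> (\<forall>i j :: 'i. \<exists>k. i \<le> k \<and> j \<le> k)"

definition tails :: "'i::preorder filter"
  where "tails = (INF i. principal {i..})"

lemma eventually_tails:
  assumes "directed_type TYPE('i::preorder)"
  shows "eventually P (tails :: 'i filter) \<longleftrightarrow> (\<exists>i. \<forall>j\<ge>i. P j)"
proof -
  have "eventually P (tails :: 'i filter) \<longleftrightarrow> (\<exists>i\<in>UNIV. eventually P (principal {i..}))"
    unfolding tails_def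
  proof (rule eventually_INF_base)
    fix a b :: 'i
    from assms obtain k where "a \<le> k" "b \<le> k"
      unfolding directed_type_def by blast
    then show "\<exists>x\<in>UNIV. principal {x..} \<le> inf (principal {a..}) (principal {b..})"
      by (auto intro!: bexI[of _ k] intro: order_trans)
  qed simp
  then show ?thesis
    by (simp add: eventually_principal Ball_def)
qed

definition left_Folner_net :: "('i::preorder \<Rightarrow> 's::semigroup_mult set) \<Rightarrow> bool"
  where "left_Folner_net F \<longleftrightarrow>
    directed_type TYPE('i) \<and>
    (\<forall>i. finite (F i) \<and> F i \<noteq> {}) \<and>
    (\<forall>s. ((\<lambda>i. real (card ((\<lambda>x. s * x) ` F i - F i)) / real (card (F i))) \<longlongrightarrow> 0) tails)"


section \<open>Actions\<close>

definition left_action :: "('s::monoid_mult \<Rightarrow> 'c \<Rightarrow> 'c) \<Rightarrow> bool"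
  where "left_action \<gamma> \<longleftrightarrow> \<gamma> 1 = id \<and> (\<forall>s t. \<gamma> (s * t) = \<gamma> s \<circ> \<gamma> t)"

definition right_action :: "('s::monoid_mult \<Rightarrow> 'c \<Rightarrow> 'c) \<Rightarrow> bool"
  where "right_action \<beta> \<longleftrightarrow> \<beta> 1 = id \<and> (\<forall>s t. \<beta> (s * t) = \<beta> t \<circ> \<beta> s)"


section \<open>Topological entropy\<close>

definition totally_disconnected :: "'a::topological_space set \<Rightarrow> bool"
  where "totally_disconnected X \<longleftrightarrow> (\<forall>C\<subseteq>X. connected C \<longrightarrow> (\<exists>x. C \<subseteq> {x}))"

definition open_cover :: "'c::topological_space set set \<Rightarrow> bool"
  where "open_cover \<U> \<longleftrightarrow> (\<forall>U\<in>\<U>. open U) \<and> \<Union>\<U> = UNIV"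

text \<open>
  Only finite subcovers are considered, because \<^const>\<open>card\<close> is \<open>0\<close> on infinite sets; an open cover
  of a compact space always has one.
\<close>

definition min_subcover_card :: "'c set set \<Rightarrow> nat"
  where "min_subcover_card \<U> =
    (LEAST n. \<exists>\<V>\<subseteq>\<U>. finite \<V> \<and> \<Union>\<V> = UNIV \<and> card \<V> = n)"

text \<open>
  The iterated join of the covers \<open>\<gamma>(s)\<^sup>-\<^sup>1(\<U>)\<close>, for \<open>s\<close> in \<open>F\<close>: a member is obtained by choosing one
  \<open>V s\<close> from \<open>\<U>\<close> for every \<open>s \<in> F\<close>.
\<close>

definition join_cover :: "('s \<Rightarrow> 'c \<Rightarrow> 'c) \<Rightarrow> 's set \<Rightarrow> 'c set set \<Rightarrow> 'c set set"
  where "join_cover \<gamma> F \<U> = {\<Inter>s\<in>F. \<gamma> s -` V s | V. \<forall>s\<in>F. V s \<in> \<U>}"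

text \<open>
  Both entropies are limits along a left Folner net, which is kept as a parameter \<open>F\<close>. For actions
  of cancellative left amenable monoids on compact spaces (respectively on abelian groups) these
  limits are known to exist and not to depend on the net.
\<close>

definition H_top ::
    "('i::preorder \<Rightarrow> 's::monoid_mult set) \<Rightarrow> ('s \<Rightarrow> 'c \<Rightarrow> 'c::topological_space) \<Rightarrow> 'c set set \<Rightarrow> real"
  where "H_top F \<gamma> \<U> =
    Lim tails (\<lambda>i. ln (real (min_subcover_card (join_cover \<gamma> (F i) \<U>))) / real (card (F i)))"

definition h_top ::
    "('i::preorder \<Rightarrow> 's::monoid_mult set) \<Rightarrow> ('s \<Rightarrow> 'c \<Rightarrow> 'c::topological_space) \<Rightarrow> ereal"
  where "h_top F \<gamma> = (SUP \<U>\<in>{\<U>. open_cover \<U>}. ereal (H_top F \<gamma> \<U>))"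


section \<open>Algebraic entropy of a right action\<close>

text \<open>The sum is the elementwise sum of subsets, from \<^theory>\<open>HOL-Library.Set_Algebras\<close>.\<close>

definition trajectory :: "('s \<Rightarrow> 'a \<Rightarrow> 'a::ab_group_add) \<Rightarrow> 's set \<Rightarrow> 'a set \<Rightarrow> 'a set"
  where "trajectory \<beta> F X = (\<Sum>s\<in>F. \<beta> s ` X)"

definition H_alg ::
    "('i::preorder \<Rightarrow> 's::monoid_mult set) \<Rightarrow> ('s \<Rightarrow> 'a \<Rightarrow> 'a::ab_group_add) \<Rightarrow> 'a set \<Rightarrow> real"
  where "H_alg F \<beta> X =
    Lim tails (\<lambda>i. ln (real (card (trajectory \<beta> (F i) X))) / real (card (F i)))"

definition h_alg ::
    "('i::preorder \<Rightarrow> 's::monoid_mult set) \<Rightarrow> ('s \<Rightarrow> 'a \<Rightarrow> 'a::ab_group_add) \<Rightarrow> ereal"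
  where "h_alg F \<beta> = (SUP X\<in>{X. finite X \<and> X \<noteq> {}}. ereal (H_alg F \<beta> X))"


section \<open>The Pontryagin dual\<close>

text \<open>
  The circle group is the multiplicative group of complex numbers of modulus \<open>1\<close>; the dual group,
  with pointwise multiplication of characters, is written additively. Its (discrete) topology is
  not needed for the algebraic entropy.
\<close>

typedef (overloaded) ('k::topological_ab_group_add) dual =
  "{\<phi>. continuous_on UNIV (\<phi> :: 'k \<Rightarrow> complex) \<and>
       (\<forall>x. norm (\<phi> x) = 1) \<and> (\<forall>x y. \<phi> (x + y) = \<phi> x * \<phi> y)}"
  morphisms char_fun Abs_dual
  by (rule exI[of _ "\<lambda>_. 1"]) simp

setup_lifting type_definition_dual

instantiation dual :: (topological_ab_group_add) ab_group_add
begin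

lift_definition zero_dual :: "'a dual" is "\<lambda>_. 1"
  by simp

lift_definition plus_dual :: "'a dual \<Rightarrow> 'a dual \<Rightarrow> 'a dual" is "\<lambda>\<phi> \<psi> x. \<phi> x * \<psi> x"
  by (auto intro!: continuous_intros simp: norm_mult)

lift_definition uminus_dual :: "'a dual \<Rightarrow> 'a dual" is "\<lambda>\<phi> x. inverse (\<phi> x)"
  by (auto intro!: continuous_on_inverse simp: norm_inverse) (metis norm_zero zero_neq_one)

definition minus_dual :: "'a dual \<Rightarrow> 'a dual \<Rightarrow> 'a dual"
  where "minus_dual \<phi> \<psi> = \<phi> + - \<psi>"

instance
proof
  fix a b c :: "'a dual"
  show "a + b + c = a + (b + c)"
    by transfer (simp add: mult.assoc)
  show "a + b = b + a"
    by transfer (simp add: mult.commute)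
  show "0 + a = a"
    by transfer simp
  show "- a + a = 0"
    by transfer (auto simp: fun_eq_iff intro!: left_inverse, metis norm_zero zero_neq_one)
  show "a - b = a + - b"
    by (rule minus_dual_def)
qed

end

definition continuous_endo :: "('k::topological_ab_group_add \<Rightarrow> 'k) \<Rightarrow> bool"
  where "continuous_endo f \<longleftrightarrow> continuous_on UNIV f \<and> Modules.additive f"

text \<open>Meaningful for continuous endomorphisms \<open>f\<close> only.\<close>

definition dual_map :: "('k::topological_ab_group_add \<Rightarrow> 'k) \<Rightarrow> 'k dual \<Rightarrow> 'k dual"
  where "dual_map f \<phi> = Abs_dual (char_fun \<phi> \<circ> f)"

lemma char_fun_dual_map:
  assumes "continuous_endo f"
  shows "char_fun (dual_map f \<phi>) = char_fun \<phi> \<circ> f"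
proof -
  have "char_fun \<phi> \<circ> f \<in> {\<phi>. continuous_on UNIV \<phi> \<and> (\<forall>x. norm (\<phi> x) = 1) \<and>
      (\<forall>x y. \<phi> (x + y) = \<phi> x * \<phi> y)}"
    using assms char_fun[of \<phi>]
    by (auto simp: continuous_endo_def Modules.additive.add
        intro: continuous_on_compose2[of UNIV _ UNIV f])
  then show ?thesis
    by (simp add: dual_map_def Abs_dual_inverse)
qed

definition dual_action ::
    "('s \<Rightarrow> 'k \<Rightarrow> 'k) \<Rightarrow> 's \<Rightarrow> 'k dual \<Rightarrow> 'k::topological_ab_group_add dual"
  where "dual_action \<gamma> s = dual_map (\<gamma> s)"

lemma additive_dual_action:
  assumes "continuous_endo (\<gamma> s)"
  shows "Modules.additive (dual_action \<gamma> s)"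
proof
  fix \<phi> \<psi>
  show "dual_action \<gamma> s (\<phi> + \<psi>) = dual_action \<gamma> s \<phi> + dual_action \<gamma> s \<psi>"
    unfolding dual_action_def
    by (rule char_fun_inject[THEN iffD1])
      (simp add: char_fun_dual_map[OF assms] plus_dual.rep_eq comp_def)
qed

lemma right_action_dual_action:
  assumes "left_action \<gamma>" "\<And>s. continuous_endo (\<gamma> s)"
  shows "right_action (dual_action \<gamma>)"
proof -
  have "dual_map (\<gamma> 1) \<phi> = \<phi>" for \<phi>
    by (rule char_fun_inject[THEN iffD1], subst char_fun_dual_map[OF assms(2)])
      (use assms(1) in \<open>simp add: left_action_def\<close>)
  moreover have "dual_map (\<gamma> (s * t)) \<phi> = dual_map (\<gamma> t) (dual_map (\<gamma> s) \<phi>)" for s t \<phi>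
    by (rule char_fun_inject[THEN iffD1], simp only: char_fun_dual_map[OF assms(2)])
      (use assms(1) in \<open>simp add: left_action_def comp_assoc\<close>)
  ultimately show ?thesis
    unfolding right_action_def dual_action_def by (simp add: fun_eq_iff)
qed

end

theory Submission
  imports Defs
begin

text \<open>
  Both entropies are values at almost invariant sets of a subadditive set function, hence limits
  along any Folner net by a quasi-tiling argument. Since \<open>K\<close> is profinite, every open cover is
  refined by the cosets of an open subgroup \<open>V\<close>, and every finite set of characters is contained in
  the finite annihilator of such a \<open>V\<close>. A finite group \<open>X\<close> of characters partitions \<open>K\<close> into
  exactly \<open>|X|\<close> classes, and the join of the pullbacks of this partition belongs to the trajectory
  of \<open>X\<close>; so the covers and the trajectories that determine the entropies have equal cardinality.
\<close>

section \<open>Subadditive functions of almost invariant sets\<close>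

text \<open>\<open>Lim\<close> is specified only for convergent nets, so even the monotonicity of
  both entropies and the change from the net \<open>F\<close> to the net \<open>G\<close>, whose
  index type may differ, depend on convergence. Sides matter throughout: by
  \<open>\<gamma> (a * s) = \<gamma> a \<circ> \<gamma> s\<close>, right translation of the index
  set pulls a join back along \<open>\<gamma> s\<close> and pushes a trajectory forward along the
  dual map, hence cannot increase either cardinality; left almost invariance of \<open>D\<close>, in
  turn, makes most right translates \<open>K c\<close> with \<open>c \<in> D\<close> lie inside
  \<open>D\<close>. There are no inverses, and cancellation is what keeps the cardinality of
  translates. A single tile \<open>K\<close> suffices because the density is an infimum of bounds
  valid on all sufficiently invariant sets, so that a nearly optimal bound is already available for
  the untiled remainder. On the dual side, subgroups make the comparison exact for every finite
  \<open>F\<close>, before any limit. Enough finite subgroups exist because the circle has no small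
  subgroups; enough characters exist because \<open>K\<close> is torsion modulo an open subgroup,
  which reduces their construction to finite Fourier analysis.\<close>

definition left_invariant_up_to :: "real \<Rightarrow> 's::semigroup_mult set \<Rightarrow> 's set \<Rightarrow> bool"
  where "left_invariant_up_to \<delta> T D \<longleftrightarrow> finite D \<and> D \<noteq> {} \<and>
    (\<forall>t\<in>T. real (card ((\<lambda>x. t * x) ` D - D)) \<le> \<delta> * real (card D))"

lemma card_left_translate:
  assumes "cancellative TYPE('s::semigroup_mult)"
  shows "card ((\<lambda>x. s * x) ` A) = card (A :: 's set)"
  using assms by (intro card_image) (auto simp: cancellative_def intro: inj_on_subset)

lemma card_right_translate:
  assumes "cancellative TYPE('s::semigroup_mult)"
  shows "card ((\<lambda>x. x * s) ` A) = card (A :: 's set)"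
  using assms by (intro card_image) (auto simp: cancellative_def intro: inj_on_subset)

text \<open>Counts the pairs \<open>(k, c)\<close> with \<open>k * c \<in> E\<close> by
  \<open>k\<close> rather than by \<open>c\<close>: left multiplication by \<open>k\<close> is
  injective, so each \<open>k\<close> accounts for at most \<open>card E\<close> of them.\<close>

lemma sum_card_translates_Int_le:
  fixes C E K :: "'s::semigroup_mult set"
  assumes canc: "cancellative TYPE('s)" and C: "finite C" and K: "finite K" and E: "finite E"
  shows "(\<Sum>c\<in>C. card ((\<lambda>x. x * c) ` K \<inter> E)) \<le> card K * card E"
proof -
  have "card ((\<lambda>x. x * c) ` K \<inter> E) = card {k\<in>K. k * c \<in> E}" for c
  proof -
    have "(\<lambda>x. x * c) ` K \<inter> E = (\<lambda>x. x * c) ` {k\<in>K. k * c \<in> E}"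
      by auto
    then show ?thesis
      by (simp add: card_right_translate[OF canc])
  qed
  then have "(\<Sum>c\<in>C. card ((\<lambda>x. x * c) ` K \<inter> E)) = (\<Sum>c\<in>C. card {k\<in>K. k * c \<in> E})"
    by simp
  also have "\<dots> = (\<Sum>k\<in>K. card {c\<in>C. k * c \<in> E})"
    using sum_multicount_gen[of C K "\<lambda>c k. k * c \<in> E"] C K by simp
  also have "\<dots> \<le> (\<Sum>k\<in>K. card E)"
  proof (rule sum_mono)
    fix k
    have "card {c\<in>C. k * c \<in> E} = card ((\<lambda>x. k * x) ` {c\<in>C. k * c \<in> E})"
      by (simp add: card_left_translate[OF canc])
    also have "\<dots> \<le> card E"
      using E by (intro card_mono) auto
    finally show "card {c\<in>C. k * c \<in> E} \<le> card E" .
  qed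
  finally show ?thesis by simp
qed

text \<open>A maximal subfamily with little overlap works: every further translate must meet its
  union in a proportion \<open>\<epsilon>\<close>, and averaging these intersections over
  \<open>C\<close> forces the union to be large.\<close>

lemma exists_almost_disjoint_translates:
  fixes C K :: "'s::semigroup_mult set"
  assumes canc: "cancellative TYPE('s)"
    and C: "finite C" and K: "finite K" "K \<noteq> {}" and \<epsilon>: "0 \<le> \<epsilon>" "\<epsilon> \<le> 1"
  obtains C' where "C' \<subseteq> C"
    "(1 - \<epsilon>) * real (card K * card C') \<le> real (card (\<Union>c\<in>C'. (\<lambda>x. x * c) ` K))"
    "\<epsilon> * real (card C) \<le> real (card (\<Union>c\<in>C'. (\<lambda>x. x * c) ` K))"
proof -
  let ?U = "\<lambda>C. \<Union>c\<in>C. (\<lambda>x. x * c) ` K"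
  let ?P = "\<lambda>C'. C' \<subseteq> C \<and> (1 - \<epsilon>) * real (card K * card C') \<le> real (card (?U C'))"
  have "?P {}" by simp
  then have ne: "{C'. ?P C'} \<noteq> {}" by blast
  have fin: "finite {C'. ?P C'}"
    by (rule finite_subset[of _ "Pow C"]) (use C in auto)
  obtain C' where "C' \<in> {C'. ?P C'}"
    and max': "\<forall>C''\<in>{C'. ?P C'}. C' \<subseteq> C'' \<longrightarrow> C' = C''"
    using finite_has_maximal[OF fin ne] by (elim bexE)
  then have C': "?P C'" by (elim CollectE)
  have max: "C'' = C'" if "?P C''" "C' \<subseteq> C''" for C''
    using max'[THEN bspec, OF CollectI, OF that(1)] that(2) by (metis (no_types))
  define E where "E = ?U C'"
  have finC': "finite C'" using C C' finite_subset by blast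
  have finE: "finite E" unfolding E_def using finC' K by auto
  \<comment> \<open>For \<open>c\<close> outside \<open>C'\<close>, maximality makes the enlarged
    family violate the packing bound, and inclusion-exclusion turns the missing points into
    overlap.\<close>
  have overlap: "\<epsilon> * real (card K) \<le> real (card ((\<lambda>x. x * c) ` K \<inter> E))" if c: "c \<in> C" for c
  proof (cases "c \<in> C'")
    case True
    then have "(\<lambda>x. x * c) ` K \<inter> E = (\<lambda>x. x * c) ` K"
      unfolding E_def by auto
    then show ?thesis
      using \<epsilon> by (simp add: card_right_translate[OF canc] mult_left_le_one_le)
  next
    case False
    then have "\<not> ?P (insert c C')"
      using max[of "insert c C'"] by auto
    then have "real (card (?U (insert c C'))) < (1 - \<epsilon>) * real (card K * (card C' + 1))"
      using c C' False finC' by auto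
    moreover have "?U (insert c C') = (\<lambda>x. x * c) ` K \<union> E"
      unfolding E_def by auto
    moreover have "real (card ((\<lambda>x. x * c) ` K \<union> E)) + real (card ((\<lambda>x. x * c) ` K \<inter> E))
        = real (card K) + real (card E)"
      using card_Un_Int[of "(\<lambda>x. x * c) ` K" E] finE K
      by (simp add: card_right_translate[OF canc] flip: of_nat_add)
    moreover have "(1 - \<epsilon>) * real (card K * card C') \<le> real (card E)"
      using C' unfolding E_def by simp
    ultimately show ?thesis
      by (simp add: algebra_simps)
  qed
  have "\<epsilon> * real (card C) * real (card K) = (\<Sum>c\<in>C. \<epsilon> * real (card K))"
    by simp
  also have "\<dots> \<le> (\<Sum>c\<in>C. real (card ((\<lambda>x. x * c) ` K \<inter> E)))"
    by (rule sum_mono) (rule overlap)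
  also have "\<dots> = real (\<Sum>c\<in>C. card ((\<lambda>x. x * c) ` K \<inter> E))"
    by simp
  also have "\<dots> \<le> real (card K * card E)"
    using sum_card_translates_Int_le[OF canc C K(1) finE] of_nat_mono by blast
  finally have "\<epsilon> * real (card C) \<le> real (card E)"
    using K by (simp add: card_gt_0_iff mult.commute)
  then show ?thesis
    using that[of C'] C' unfolding E_def by simp
qed

text \<open>Tiles are centred at points \<open>c \<in> D\<close> with
  \<open>K c \<subseteq> D\<close>. Invariance of \<open>D\<close> under \<open>K\<close> makes
  these at least half of \<open>D\<close>; invariance of \<open>D\<close> and of \<open>K\<close>
  under \<open>T\<close> keeps the remainder almost invariant under \<open>T\<close>, though only
  relative to \<open>card D\<close>.\<close>

lemma partial_tiling:
  fixes K D :: "'s::semigroup_mult set"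
  assumes canc: "cancellative TYPE('s)"
    and K: "left_invariant_up_to \<delta>' T K" and D: "left_invariant_up_to \<delta> (T \<union> K) D"
    and \<epsilon>: "0 \<le> \<epsilon>" "\<epsilon> \<le> 1 / 2" and \<delta>: "real (card K) * \<delta> \<le> 1 / 2" and \<delta>': "0 \<le> \<delta>'"
  obtains C where "finite C" "(\<Union>c\<in>C. (\<lambda>x. x * c) ` K) \<subseteq> D"
    "real (card K * card C) \<le> (1 + 2 * \<epsilon>) * real (card (\<Union>c\<in>C. (\<lambda>x. x * c) ` K))"
    "\<epsilon> / 2 * real (card D) \<le> real (card (\<Union>c\<in>C. (\<lambda>x. x * c) ` K))"
    "\<forall>t\<in>T. real (card ((\<lambda>x. t * x) ` (D - (\<Union>c\<in>C. (\<lambda>x. x * c) ` K)) -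
        (D - (\<Union>c\<in>C. (\<lambda>x. x * c) ` K)))) \<le> (\<delta> + 2 * \<delta>') * real (card D)"
proof -
  have finK: "finite K" "K \<noteq> {}" and finD: "finite D" "D \<noteq> {}"
    using K D by (auto simp: left_invariant_up_to_def)
  define C where "C = {c\<in>D. \<forall>k\<in>K. k * c \<in> D}"
  have finC: "finite C" unfolding C_def using finD by simp
  have "D - C \<subseteq> (\<Union>k\<in>K. {c\<in>D. k * c \<notin> D})"
    unfolding C_def by auto
  then have "card (D - C) \<le> card (\<Union>k\<in>K. {c\<in>D. k * c \<notin> D})"
    using finD finK by (intro card_mono) auto
  also have "\<dots> \<le> (\<Sum>k\<in>K. card {c\<in>D. k * c \<notin> D})"
    using finK(1) by (rule card_UN_le)
  finally have "real (card (D - C)) \<le> real (\<Sum>k\<in>K. card {c\<in>D. k * c \<notin> D})"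
    by (rule of_nat_mono)
  also have "\<dots> = (\<Sum>k\<in>K. real (card {c\<in>D. k * c \<notin> D}))"
    by simp
  also have "\<dots> \<le> (\<Sum>k\<in>K. \<delta> * real (card D))"
  proof (rule sum_mono)
    fix k assume "k \<in> K"
    have "(\<lambda>x. k * x) ` {c\<in>D. k * c \<notin> D} = (\<lambda>x. k * x) ` D - D"
      by auto
    then have "card {c\<in>D. k * c \<notin> D} = card ((\<lambda>x. k * x) ` D - D)"
      using card_left_translate[OF canc, of k "{c\<in>D. k * c \<notin> D}"] by simp
    then show "real (card {c\<in>D. k * c \<notin> D}) \<le> \<delta> * real (card D)"
      using D \<open>k \<in> K\<close> by (auto simp: left_invariant_up_to_def)
  qed
  also have "\<dots> = real (card K) * \<delta> * real (card D)"
    by simp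
  also have "\<dots> \<le> 1 / 2 * real (card D)"
    using \<delta> by (rule mult_right_mono) simp
  finally have "real (card (D - C)) \<le> 1 / 2 * real (card D)" .
  moreover have "card (D - C) = card D - card C" "card C \<le> card D"
    using finD finC unfolding C_def by (auto intro!: card_Diff_subset card_mono)
  ultimately have cardC: "real (card D) / 2 \<le> real (card C)"
    by (simp add: of_nat_diff)
  obtain C' where C': "C' \<subseteq> C"
    "(1 - \<epsilon>) * real (card K * card C') \<le> real (card (\<Union>c\<in>C'. (\<lambda>x. x * c) ` K))"
    "\<epsilon> * real (card C) \<le> real (card (\<Union>c\<in>C'. (\<lambda>x. x * c) ` K))"
    using exists_almost_disjoint_translates[OF canc finC finK, of \<epsilon>] \<epsilon> by auto
  define E where "E = (\<Union>c\<in>C'. (\<lambda>x. x * c) ` K)"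
  have finC': "finite C'" using C'(1) finC finite_subset by blast
  have ED: "E \<subseteq> D" unfolding E_def using C'(1) by (auto simp: C_def)
  have finE: "finite E" using ED finD(1) finite_subset by blast
  \<comment> \<open>Since \<open>\<epsilon> \<le> 1 / 2\<close>, the factor
    \<open>1 - \<epsilon>\<close> on the small side of the packing bound can be traded for
    \<open>1 + 2 * \<epsilon>\<close> on the large side.\<close>
  have "1 \<le> (1 + 2 * \<epsilon>) * (1 - \<epsilon>)"
    using \<epsilon> mult_nonneg_nonneg[of \<epsilon> "1 - 2 * \<epsilon>"] by (simp add: algebra_simps)
  then have "1 * real (card K * card C') \<le> ((1 + 2 * \<epsilon>) * (1 - \<epsilon>)) * real (card K * card C')"
    by (rule mult_right_mono) simp
  also have "\<dots> \<le> (1 + 2 * \<epsilon>) * real (card E)"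
    using C'(2) \<epsilon> unfolding E_def mult.assoc by (intro mult_left_mono) auto
  finally have packing: "real (card K * card C') \<le> (1 + 2 * \<epsilon>) * real (card E)" by simp
  have "\<epsilon> / 2 * real (card D) = \<epsilon> * (real (card D) / 2)" by simp
  also have "\<dots> \<le> \<epsilon> * real (card C)"
    using cardC \<epsilon> by (intro mult_left_mono) auto
  finally have large: "\<epsilon> / 2 * real (card D) \<le> real (card E)"
    using C'(3) unfolding E_def by simp
  have rest: "real (card ((\<lambda>x. t * x) ` (D - E) - (D - E))) \<le> (\<delta> + 2 * \<delta>') * real (card D)"
    if t: "t \<in> T" for t
  proof -
    \<comment> \<open>A point of \<open>D - E\<close> that \<open>t\<close> moves into a tile
      \<open>K c\<close> lands at some \<open>k * c\<close> with \<open>k\<close> outside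
      \<open>t K\<close>: otherwise left cancellation would put the point itself into that
      tile.\<close>
    let ?B = "\<Union>c\<in>C'. (\<lambda>x. x * c) ` (K - (\<lambda>x. t * x) ` K)"
    have "(\<lambda>x. t * x) ` (D - E) - (D - E) \<subseteq> ((\<lambda>x. t * x) ` D - D) \<union> ?B"
    proof
      fix y assume y: "y \<in> (\<lambda>x. t * x) ` (D - E) - (D - E)"
      then obtain x where x: "x \<in> D" "x \<notin> E" "y = t * x" by auto
      show "y \<in> ((\<lambda>x. t * x) ` D - D) \<union> ?B"
      proof (cases "y \<in> D")
        case True
        then obtain c k where ck: "c \<in> C'" "k \<in> K" "y = k * c"
          using y unfolding E_def by auto
        have "k \<notin> (\<lambda>x. t * x) ` K"
        proof
          assume "k \<in> (\<lambda>x. t * x) ` K"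
          then obtain k' where k': "k' \<in> K" "k = t * k'" by auto
          then have "t * x = t * (k' * c)"
            using x ck by (simp add: mult.assoc)
          then have "x = k' * c"
            using canc unfolding cancellative_def by (blast dest: injD)
          then show False
            using x(2) ck(1) k'(1) unfolding E_def by auto
        qed
        then show ?thesis using ck by auto
      qed (use x in auto)
    qed
    then have "card ((\<lambda>x. t * x) ` (D - E) - (D - E)) \<le> card (((\<lambda>x. t * x) ` D - D) \<union> ?B)"
      using finD finC' finK by (intro card_mono) auto
    also have "\<dots> \<le> card ((\<lambda>x. t * x) ` D - D) + card ?B"
      by (rule card_Un_le)
    finally have 1: "card ((\<lambda>x. t * x) ` (D - E) - (D - E))
        \<le> card ((\<lambda>x. t * x) ` D - D) + card ?B" .
    have "card ?B \<le> (\<Sum>c\<in>C'. card ((\<lambda>x. x * c) ` (K - (\<lambda>x. t * x) ` K)))"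
      using finC' by (rule card_UN_le)
    also have "\<dots> = card C' * card (K - (\<lambda>x. t * x) ` K)"
      by (simp add: card_right_translate[OF canc])
    \<comment> \<open>\<open>K\<close> and \<open>t K\<close> have equal cardinality, so as many
      points enter \<open>K\<close> as leave it, and the invariance of \<open>K\<close>
      applies.\<close>
    also have "card (K - (\<lambda>x. t * x) ` K) = card ((\<lambda>x. t * x) ` K - K)"
      using finK by (intro card_le_sym_Diff[THEN antisym] card_le_sym_Diff)
        (auto simp: card_left_translate[OF canc])
    finally have "real (card ?B) \<le> real (card C' * card ((\<lambda>x. t * x) ` K - K))"
      by (rule of_nat_mono)
    also have "\<dots> = real (card C') * real (card ((\<lambda>x. t * x) ` K - K))"
      by simp
    also have "\<dots> \<le> real (card C') * (\<delta>' * real (card K))"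
      using K t by (intro mult_left_mono) (auto simp: left_invariant_up_to_def)
    also have "\<dots> = \<delta>' * real (card K * card C')"
      by simp
    also have "\<dots> \<le> \<delta>' * ((1 + 2 * \<epsilon>) * real (card E))"
      using packing \<delta>' by (rule mult_left_mono)
    \<comment> \<open>The coefficient \<open>2\<close> of \<open>\<delta>'\<close> comes from
      \<open>1 + 2 * \<epsilon> \<le> 2\<close>.\<close>
    also have "\<dots> \<le> \<delta>' * (2 * real (card D))"
      using \<delta>' \<epsilon> ED finD by (intro mult_left_mono mult_mono) (auto intro: card_mono)
    finally have "real (card ?B) \<le> 2 * \<delta>' * real (card D)" by simp
    moreover have "real (card ((\<lambda>x. t * x) ` D - D)) \<le> \<delta> * real (card D)"
      using D t by (auto simp: left_invariant_up_to_def)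
    ultimately show ?thesis
      using of_nat_mono[OF 1, where 'a=real] by (simp add: algebra_simps)
  qed
  show ?thesis
    by (rule that[of C']) (use finC' ED packing large rest in \<open>simp_all add: E_def\<close>)
qed

section \<open>Convergence along Folner nets\<close>

lemma tails_neq_bot:
  assumes "directed_type TYPE('i::preorder)"
  shows "(tails :: 'i filter) \<noteq> bot"
  using eventually_tails[OF assms, of "\<lambda>_. False"] by (auto simp: trivial_limit_def)

lemma eventually_left_invariant:
  fixes F :: "'i::preorder \<Rightarrow> 's::semigroup_mult set"
  assumes F: "left_Folner_net F" and T: "finite T" and \<delta>: "\<delta> > 0"
  shows "eventually (\<lambda>i. left_invariant_up_to \<delta> T (F i)) tails"
proof -
  have "eventually (\<lambda>i. \<forall>t\<in>T. real (card ((\<lambda>x. t * x) ` F i - F i)) / real (card (F i)) < \<delta>) tails"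
    using F \<delta> by (intro eventually_ball_finite[OF T] ballI order_tendstoD(2)) (auto simp: left_Folner_net_def)
  then show ?thesis
  proof eventually_elim
    case (elim i)
    have "finite (F i)" "F i \<noteq> {}" "0 < card (F i)"
      using F by (auto simp: left_Folner_net_def card_gt_0_iff)
    then show ?case
      using elim unfolding left_invariant_up_to_def by (auto simp: pos_divide_less_eq less_imp_le)
  qed
qed

text \<open>\<open>translate\<close> is an inequality because \<open>\<gamma> s\<close> need not be
  injective or surjective: images of trajectories and pulled back subcovers may shrink.\<close>

locale subadditive_set_function =
  fixes h :: "'s::monoid_mult set \<Rightarrow> real"
  assumes canc: "cancellative TYPE('s)"
    and nonneg: "finite A \<Longrightarrow> 0 \<le> h A"
    and empty: "h {} = 0"
    and subadd: "finite A \<Longrightarrow> finite B \<Longrightarrow> h (A \<union> B) \<le> h A + h B"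
    and translate: "finite A \<Longrightarrow> h ((\<lambda>x. x * s) ` A) \<le> h A"
begin

lemma le_sum: "finite I \<Longrightarrow> (\<And>i. i \<in> I \<Longrightarrow> finite (A i)) \<Longrightarrow> h (\<Union>i\<in>I. A i) \<le> (\<Sum>i\<in>I. h (A i))"
proof (induction I rule: finite_induct)
  case (insert i I)
  have "h (\<Union>j\<in>insert i I. A j) \<le> h (A i) + h (\<Union>j\<in>I. A j)"
    using insert by (simp add: subadd)
  then show ?case using insert by force
qed (simp add: empty)

lemma le_card: 
  assumes "finite A"
  shows "h A \<le> h {1} * real (card A)"
proof -
  have "h A = h (\<Union>a\<in>A. {a})" by simp
  also have "\<dots> \<le> (\<Sum>a\<in>A. h {a})"
    using assms by (intro le_sum) auto
  also have "\<dots> \<le> (\<Sum>a\<in>A. h {1})"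
  proof (rule sum_mono)
    fix a show "h {a} \<le> h {1}"
      using translate[of "{1}" a] by simp
  qed
  finally show ?thesis by (simp add: mult.commute)
qed

definition asymptotic_bound :: "real \<Rightarrow> bool"
  where "asymptotic_bound a \<longleftrightarrow> (\<exists>T \<delta>. finite T \<and> \<delta> > 0 \<and>
    (\<forall>D. left_invariant_up_to \<delta> T D \<longrightarrow> h D \<le> a * real (card D)))"

text \<open>The upper limit of \<open>h D / card D\<close> as \<open>D\<close> becomes more and more
  invariant.\<close>

definition asymptotic_density :: real
  where "asymptotic_density = Inf {a. asymptotic_bound a}"

lemma asymptotic_bound_h_one: "asymptotic_bound (h {1})"
  unfolding asymptotic_bound_def
  by (rule exI[of _ "{}"], rule exI[of _ 1]) (auto simp: left_invariant_up_to_def le_card)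

text \<open>
  Tiling part of \<open>D\<close> with translates of \<open>K\<close> leaves a set which is again almost invariant, so that
  \<open>asymptotic_density + \<eta>\<close> bounds \<open>h\<close> on it. As the tiled part is a fixed proportion of \<open>D\<close>,
  letting \<open>\<eta>\<close> tend to \<open>0\<close> shows that the density cannot exceed the value on \<open>K\<close>.
\<close>

lemma asymptotic_density_le:
  assumes *: "\<And>T \<delta>. finite T \<Longrightarrow> \<delta> > 0 \<Longrightarrow> \<exists>K. left_invariant_up_to \<delta> T K \<and> h K \<le> l * real (card K)"
  shows "asymptotic_density \<le> l"
proof (rule ccontr)
  define L where "L = asymptotic_density"
  define c where "c = h {1}"
  assume "\<not> asymptotic_density \<le> l"
  then have l: "l < L" by (simp add: L_def)
  have nonneg_bound: "0 \<le> a" if "left_invariant_up_to \<delta> T K" "h K \<le> a * real (card K)" for \<delta> T K a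
  proof -
    have "0 \<le> a * real (card K)" "0 < card K"
      using that nonneg[of K] by (auto simp: left_invariant_up_to_def card_gt_0_iff)
    then show ?thesis by (simp add: zero_le_mult_iff)
  qed
  have "0 \<le> l"
    using *[of "{}" 1] nonneg_bound by auto
  have "0 \<le> c" by (simp add: c_def nonneg)
  \<comment> \<open>Without almost invariant sets every number would vacuously be an asymptotic
    bound; the sets given by the assumption exclude this.\<close>
  have bdd: "bdd_below {a. asymptotic_bound a}"
  proof (rule bdd_belowI)
    fix a assume "a \<in> {a. asymptotic_bound a}"
    then show "0 \<le> a"
      using * nonneg_bound unfolding asymptotic_bound_def by blast
  qed
  \<comment> \<open>Against \<open>L\<close>, the saving per element is \<open>g\<close> if tiles
    cost \<open>m\<close> per element and an exceptional proportion \<open>\<epsilon>\<close> of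
    \<open>D\<close> costs \<open>c\<close> per element. The choice of \<open>\<epsilon>\<close>
    gives \<open>g = L - l - \<epsilon> * (2 * l + c) > (L - l) / 2\<close>; the summand
    \<open>1\<close> keeps the denominator positive.\<close>
  define \<epsilon> where "\<epsilon> = min (1/2) ((L - l) / (2 * (2 * l + c + 1)))"
  define m where "m = l * (1 + 2 * \<epsilon>)"
  define g where "g = L - m - c * \<epsilon>"
  have pos: "0 < 2 * (2 * l + c + 1)"
    using \<open>0 \<le> l\<close> \<open>0 \<le> c\<close> by simp
  have \<epsilon>: "0 < \<epsilon>" "\<epsilon> \<le> 1/2"
    using l pos unfolding \<epsilon>_def by (simp, intro min.cobounded1)
  have "\<epsilon> \<le> (L - l) / (2 * (2 * l + c + 1))"
    by (simp add: \<epsilon>_def)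
  then have "\<epsilon> * (2 * (2 * l + c + 1)) \<le> L - l"
    by (subst (asm) pos_le_divide_eq[OF pos])
  have "0 < g"
  proof -
    have "0 < 2 * g"
      using \<epsilon> l \<open>\<epsilon> * (2 * (2 * l + c + 1)) \<le> L - l\<close> unfolding g_def m_def
      by (simp add: algebra_simps)
    then show ?thesis by simp
  qed
  \<comment> \<open>Tiles fill at least \<open>\<epsilon> / 2\<close> of \<open>D\<close> and save
    \<open>g\<close> per element, in total \<open>2 * \<eta>\<close> per element of
    \<open>D\<close>: twice the excess \<open>\<eta>\<close> allowed in the bound for the
    remainder.\<close>
  define \<eta> where "\<eta> = \<epsilon> * g / 4"
  have \<eta>: "0 < \<eta>" "\<eta> \<le> g"
    using \<epsilon> \<open>0 < g\<close> unfolding \<eta>_def by (auto simp: field_simps)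
  have "Inf {a. asymptotic_bound a} < L + \<eta>"
    using \<eta> by (simp add: L_def asymptotic_density_def)
  then obtain a where a: "asymptotic_bound a" "a < L + \<eta>"
    using cInf_lessD[of "{a. asymptotic_bound a}"] asymptotic_bound_h_one by blast
  then obtain T \<delta> where T: "finite T" "0 < \<delta>"
    "\<And>D. left_invariant_up_to \<delta> T D \<Longrightarrow> h D \<le> a * real (card D)"
    unfolding asymptotic_bound_def by blast
  \<comment> \<open>The remainder is invariant up to
    \<open>\<delta>2 + 2 * \<delta>' \<le> 3 * \<delta>'\<close> relative to \<open>D\<close>; if it
    keeps a proportion \<open>\<epsilon>\<close> of \<open>D\<close>, this amounts to at most
    \<open>\<delta>\<close> relative to itself.\<close>
  define \<delta>' where "\<delta>' = \<epsilon> * \<delta> / 3"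
  have "0 < \<delta>'" using \<epsilon> T by (simp add: \<delta>'_def)
  obtain K where K: "left_invariant_up_to \<delta>' T K" "h K \<le> l * real (card K)"
    using *[OF T(1) \<open>0 < \<delta>'\<close>] by blast
  have finK: "finite K" "0 < card K"
    using K(1) by (auto simp: left_invariant_up_to_def card_gt_0_iff)
  \<comment> \<open>The second bound lets half of \<open>D\<close> serve as centres of
    tiles.\<close>
  define \<delta>2 where "\<delta>2 = min \<delta>' (1 / (2 * real (card K)))"
  have "0 < \<delta>2" using \<open>0 < \<delta>'\<close> finK by (simp add: \<delta>2_def)
  have "real (card K) * \<delta>2 \<le> real (card K) * (1 / (2 * real (card K)))"
    by (intro mult_left_mono) (auto simp: \<delta>2_def)
  also have "\<dots> = 1 / 2" using finK by (auto simp: card_gt_0_iff)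
  finally have \<delta>2K: "real (card K) * \<delta>2 \<le> 1 / 2" .
  \<comment> \<open>An asymptotic bound below the infimum \<open>L\<close> is the contradiction
    sought.\<close>
  have "asymptotic_bound (L - \<eta>)"
    unfolding asymptotic_bound_def
  proof (intro exI conjI allI impI)
    show "finite (T \<union> K)" "0 < \<delta>2" by (use T finK \<open>0 < \<delta>2\<close> in auto)
    fix D assume D: "left_invariant_up_to \<delta>2 (T \<union> K) D"
    have finD: "finite D" "0 < card D"
      using D by (auto simp: left_invariant_up_to_def card_gt_0_iff)
    obtain C where C: "finite C" "(\<Union>c\<in>C. (\<lambda>x. x * c) ` K) \<subseteq> D"
      "real (card K * card C) \<le> (1 + 2 * \<epsilon>) * real (card (\<Union>c\<in>C. (\<lambda>x. x * c) ` K))"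
      "\<epsilon> / 2 * real (card D) \<le> real (card (\<Union>c\<in>C. (\<lambda>x. x * c) ` K))"
      "\<forall>t\<in>T. real (card ((\<lambda>x. t * x) ` (D - (\<Union>c\<in>C. (\<lambda>x. x * c) ` K)) -
        (D - (\<Union>c\<in>C. (\<lambda>x. x * c) ` K)))) \<le> (\<delta>2 + 2 * \<delta>') * real (card D)"
      by (rule partial_tiling[OF canc K(1) D less_imp_le[OF \<epsilon>(1)] \<epsilon>(2) \<delta>2K
            less_imp_le[OF \<open>0 < \<delta>'\<close>]])
    define E where "E = (\<Union>c\<in>C. (\<lambda>x. x * c) ` K)"
    note C = C[folded E_def]
    have finE: "finite E" using C(2) finD finite_subset by blast
    have cardDE: "real (card (D - E)) = real (card D) - real (card E)"
      using C(2) finE finD by (simp add: card_Diff_subset of_nat_diff card_mono)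
    have "h E \<le> (\<Sum>c\<in>C. h ((\<lambda>x. x * c) ` K))"
      unfolding E_def using C(1) finK by (intro le_sum) auto
    also have "\<dots> \<le> (\<Sum>c\<in>C. l * real (card K))"
      using translate[OF finK(1)] K(2) by (intro sum_mono) (meson order_trans)
    also have "\<dots> = l * real (card K * card C)" by simp
    also have "\<dots> \<le> l * ((1 + 2 * \<epsilon>) * real (card E))"
      using C(3) \<open>0 \<le> l\<close> by (rule mult_left_mono)
    finally have hE: "h E \<le> m * real (card E)" by (simp add: m_def mult.assoc)
    have "D = E \<union> (D - E)" using C(2) by auto
    then have hD: "h D \<le> h E + h (D - E)"
      using subadd[of E "D - E"] finE finD by auto
    show "h D \<le> (L - \<eta>) * real (card D)"
    proof (cases "\<epsilon> * real (card D) \<le> real (card (D - E))")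
      case True
      have "left_invariant_up_to \<delta> T (D - E)"
        unfolding left_invariant_up_to_def
      proof (intro conjI ballI)
        show "finite (D - E)" using finD by simp
        show "D - E \<noteq> {}"
        proof
          assume "D - E = {}"
          then have "\<epsilon> * real (card D) \<le> 0" using True by (simp only: card.empty of_nat_0)
          then show False using \<epsilon> finD by (simp add: mult_le_0_iff)
        qed
        fix t assume "t \<in> T"
        then have "real (card ((\<lambda>x. t * x) ` (D - E) - (D - E))) \<le> (\<delta>2 + 2 * \<delta>') * real (card D)"
          by (rule C(5)[rule_format])
        also have "\<dots> \<le> (\<epsilon> * \<delta>) * real (card D)"
          by (rule mult_right_mono) (auto simp: \<delta>2_def \<delta>'_def)
        also have "\<dots> = \<delta> * (\<epsilon> * real (card D))" by simp
        also have "\<dots> \<le> \<delta> * real (card (D - E))"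
          using True T(2) by (intro mult_left_mono) auto
        finally show "real (card ((\<lambda>x. t * x) ` (D - E) - (D - E))) \<le> \<delta> * real (card (D - E))" .
      qed
      then have "h (D - E) \<le> a * real (card (D - E))" by (rule T(3))
      also have "\<dots> \<le> (L + \<eta>) * real (card (D - E))"
        using a by (intro mult_right_mono) auto
      finally have "h D \<le> m * real (card E) + (L + \<eta>) * (real (card D) - real (card E))"
        using hD hE cardDE by simp
      then have "h D \<le> (L + \<eta>) * real (card D) - (L - m + \<eta>) * real (card E)"
        by (simp add: algebra_simps)
      moreover have "0 \<le> c * \<epsilon>" using \<open>0 \<le> c\<close> \<epsilon> by simp
      then have "g \<le> L - m + \<eta>" using \<eta> by (simp add: g_def)
      then have "g * (\<epsilon> / 2 * real (card D)) \<le> (L - m + \<eta>) * real (card E)"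
        using C(4) \<open>0 < g\<close> \<epsilon> by (intro mult_mono) auto
      moreover have "g * (\<epsilon> / 2 * real (card D)) = 2 * \<eta> * real (card D)"
        by (simp add: \<eta>_def)
      ultimately have "h D \<le> (L + \<eta>) * real (card D) - 2 * \<eta> * real (card D)"
        by linarith
      then show ?thesis by (simp add: algebra_simps)
    next
      \<comment> \<open>Such a remainder may be far from invariant, but it is small enough for the
        crude bound \<open>c\<close> per element.\<close>
      case False
      have "0 \<le> m" using \<epsilon> \<open>0 \<le> l\<close> by (simp add: m_def)
      have "h D \<le> m * real (card E) + c * real (card (D - E))"
        using hD hE le_card[of "D - E"] finD by (simp add: c_def)
      also have "\<dots> \<le> m * real (card D) + c * (\<epsilon> * real (card D))"
        using False \<open>0 \<le> c\<close> \<open>0 \<le> m\<close> C(2) finD by (intro add_mono mult_left_mono) (auto intro: card_mono)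
      also have "\<dots> = (L - g) * real (card D)"
        by (simp add: g_def algebra_simps)
      also have "\<dots> \<le> (L - \<eta>) * real (card D)"
        using \<eta> by (intro mult_right_mono) auto
      finally show ?thesis .
    qed
  qed
  then have "L \<le> L - \<eta>"
    unfolding L_def asymptotic_density_def using bdd by (intro cInf_lower) auto
  then show False using \<eta> by simp
qed

text \<open>The upper estimate is the definition of the density. If the lower one failed, the net
  would contain arbitrarily invariant sets with quotient at most \<open>a\<close>, and these could
  serve as tiles in \<open>asymptotic_density_le\<close>.\<close>

theorem Ornstein_Weiss:
  fixes F :: "'i::preorder \<Rightarrow> 's set"
  assumes F: "left_Folner_net F"
  shows "((\<lambda>i. h (F i) / real (card (F i))) \<longlongrightarrow> asymptotic_density) tails"
proof (rule order_tendstoI)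
  have pos: "0 < card (F i)" for i
    using F by (auto simp: left_Folner_net_def card_gt_0_iff)
  fix a assume "asymptotic_density < a"
  then obtain b where b: "asymptotic_bound b" "b < a"
    using cInf_lessD[of "{a. asymptotic_bound a}"] asymptotic_bound_h_one
    unfolding asymptotic_density_def by blast
  then obtain T \<delta> where T: "finite T" "0 < \<delta>"
    "\<And>D. left_invariant_up_to \<delta> T D \<Longrightarrow> h D \<le> b * real (card D)"
    unfolding asymptotic_bound_def by blast
  show "eventually (\<lambda>i. h (F i) / real (card (F i)) < a) tails"
    using eventually_left_invariant[OF F T(1,2)]
  proof eventually_elim
    case (elim i)
    then have "h (F i) / real (card (F i)) \<le> b"
      using T(3) pos by (simp add: pos_divide_le_eq)
    then show ?case using b by simp
  qed
next
  have pos: "0 < card (F i)" for i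
    using F by (auto simp: left_Folner_net_def card_gt_0_iff)
  fix a assume a: "a < asymptotic_density"
  show "eventually (\<lambda>i. a < h (F i) / real (card (F i))) tails"
  proof (rule ccontr)
    assume contra: "\<not> ?thesis"
    have "asymptotic_density \<le> a"
    proof (rule asymptotic_density_le)
      fix T :: "'s set" and \<delta> :: real assume "finite T" "\<delta> > 0"
      then have ev: "eventually (\<lambda>i. left_invariant_up_to \<delta> T (F i)) tails"
        by (rule eventually_left_invariant[OF F])
      have "frequently (\<lambda>i. h (F i) / real (card (F i)) \<le> a) tails"
        using contra by (simp add: frequently_def not_le)
      from frequently_eventually_conj[OF this ev]
      obtain i where "h (F i) / real (card (F i)) \<le> a" "left_invariant_up_to \<delta> T (F i)"
        by (auto dest: frequently_ex)
      then show "\<exists>K. left_invariant_up_to \<delta> T K \<and> h K \<le> a * real (card K)"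
        using pos[of i] by (auto simp: pos_divide_le_eq)
    qed
    then show False using a by simp
  qed
qed

text \<open>The right-hand side does not mention \<open>F\<close>; this identifies entropies along
  nets with different index types.\<close>

lemma Lim_Folner:
  fixes F :: "'i::preorder \<Rightarrow> 's set"
  assumes F: "left_Folner_net F"
  shows "Lim tails (\<lambda>i. h (F i) / real (card (F i))) = asymptotic_density"
  proof (rule tendsto_Lim)
  show "(tails :: 'i filter) \<noteq> bot"
    using F by (intro tails_neq_bot) (simp add: left_Folner_net_def)
qed (rule Ornstein_Weiss[OF F])

end


section \<open>Covers\<close>

lemma min_subcover_card_le:
  assumes fin: "finite \<W>" and cov: "\<Union>\<W> = UNIV" and ref: "\<And>W. W \<in> \<W> \<Longrightarrow> \<exists>U\<in>\<U>. W \<subseteq> U"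
  shows "min_subcover_card \<U> \<le> card \<W>"
proof -
  obtain f where f: "\<And>W. W \<in> \<W> \<Longrightarrow> f W \<in> \<U> \<and> W \<subseteq> f W"
    using ref by metis
  have "\<Union>(f ` \<W>) = UNIV"
    using f cov by blast
  then have "min_subcover_card \<U> \<le> card (f ` \<W>)"
    unfolding min_subcover_card_def using f fin by (intro Least_le exI[of _ "f ` \<W>"]) auto
  also have "\<dots> \<le> card \<W>" using fin by (rule card_image_le)
  finally show ?thesis .
qed

lemma min_subcover:
  fixes \<U> :: "'c::topological_space set set"
  assumes comp: "compact (UNIV :: 'c set)" and \<U>: "open_cover \<U>"
  obtains \<V> where "\<V> \<subseteq> \<U>" "finite \<V>" "\<Union>\<V> = UNIV" "card \<V> = min_subcover_card \<U>"
proof -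
  obtain \<V> where "\<V> \<subseteq> \<U>" "finite \<V>" "UNIV \<subseteq> \<Union>\<V>"
    using compactE[OF comp, of \<U>] \<U> by (auto simp: open_cover_def)
  then have "\<exists>n. \<exists>\<V>\<subseteq>\<U>. finite \<V> \<and> \<Union>\<V> = UNIV \<and> card \<V> = n"
    by blast
  from LeastI_ex[OF this] show ?thesis
    using that unfolding min_subcover_card_def by blast
qed

lemma min_subcover_card_pos:
  fixes \<U> :: "'c::topological_space set set"
  assumes comp: "compact (UNIV :: 'c set)" and \<U>: "open_cover \<U>"
  shows "0 < min_subcover_card \<U>"
  using min_subcover[OF assms] by (metis UNIV_not_empty Union_empty card_gt_0_iff)

lemma min_subcover_card_mono:
  fixes \<U> \<W> :: "'c::topological_space set set"
  assumes comp: "compact (UNIV :: 'c set)" and \<W>: "open_cover \<W>"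
    and ref: "\<And>W. W \<in> \<W> \<Longrightarrow> \<exists>U\<in>\<U>. W \<subseteq> U"
  shows "min_subcover_card \<U> \<le> min_subcover_card \<W>"
proof -
  obtain \<V> where \<V>: "\<V> \<subseteq> \<W>" "finite \<V>" "\<Union>\<V> = UNIV" "card \<V> = min_subcover_card \<W>"
    using min_subcover[OF comp \<W>] .
  show ?thesis
    using min_subcover_card_le[OF \<V>(2,3), of \<U>] \<V>(1,4) ref by auto
qed

text \<open>A point of a nonempty class lies in no other class, so no such class can be omitted. A
  join of partitions may contain the empty set, which has to be discounted.\<close>

lemma min_subcover_card_partition:
  assumes cov: "\<Union>\<U> = UNIV" and fin: "finite \<U>"
    and disj: "\<And>U V. U \<in> \<U> \<Longrightarrow> V \<in> \<U> \<Longrightarrow> U \<noteq> V \<Longrightarrow> U \<inter> V = {}"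
  shows "min_subcover_card \<U> = card (\<U> - {{}})"
  unfolding min_subcover_card_def
proof (rule Least_equality)
  show "\<exists>\<V>\<subseteq>\<U>. finite \<V> \<and> \<Union>\<V> = UNIV \<and> card \<V> = card (\<U> - {{}})"
    using cov fin by (intro exI[of _ "\<U> - {{}}"]) auto
next
  fix n assume "\<exists>\<V>\<subseteq>\<U>. finite \<V> \<and> \<Union>\<V> = UNIV \<and> card \<V> = n"
  then obtain \<V> where \<V>: "\<V> \<subseteq> \<U>" "finite \<V>" "\<Union>\<V> = UNIV" "card \<V> = n" by blast
  have "\<U> - {{}} \<subseteq> \<V>"
  proof
    fix U assume U: "U \<in> \<U> - {{}}"
    then obtain x where x: "x \<in> U" by blast
    then obtain V where "V \<in> \<V>" "x \<in> V" using \<V>(3) by blast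
    then show "U \<in> \<V>"
      using disj[of U V] U x \<V>(1) by blast
  qed
  then show "card (\<U> - {{}}) \<le> n"
    using \<V>(2,4) card_mono by blast
qed

section \<open>Iterated joins and their subadditivity\<close>

lemma join_cover_empty: "join_cover \<gamma> {} \<U> = {UNIV}"
  by (auto simp: join_cover_def)

lemma open_cover_join:
  fixes \<gamma> :: "'s \<Rightarrow> 'c \<Rightarrow> 'c::topological_space"
  assumes cont: "\<And>s. continuous_on UNIV (\<gamma> s)" and \<U>: "open_cover \<U>" and F: "finite F"
  shows "open_cover (join_cover \<gamma> F \<U>)"
  unfolding open_cover_def
proof (intro conjI ballI)
  fix W assume "W \<in> join_cover \<gamma> F \<U>"
  then obtain V where V: "W = (\<Inter>s\<in>F. \<gamma> s -` V s)" "\<forall>s\<in>F. V s \<in> \<U>"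
    unfolding join_cover_def by blast
  show "open W"
    unfolding V(1)
  proof (rule open_INT[OF F], intro ballI)
    fix s assume "s \<in> F"
    then show "open (\<gamma> s -` V s)"
      using V(2) \<U> cont by (intro open_vimage) (auto simp: open_cover_def)
  qed
next
  have "x \<in> \<Union>(join_cover \<gamma> F \<U>)" for x
  proof -
    have "\<forall>s. \<exists>U\<in>\<U>. \<gamma> s x \<in> U"
      using \<U> by (auto simp: open_cover_def)
    then obtain V where V: "\<And>s. V s \<in> \<U> \<and> \<gamma> s x \<in> V s" by metis
    then have "(\<Inter>s\<in>F. \<gamma> s -` V s) \<in> join_cover \<gamma> F \<U>"
      unfolding join_cover_def by auto
    then show ?thesis
      by (rule UnionI) (use V in auto)
  qed
  then show "\<Union>(join_cover \<gamma> F \<U>) = UNIV" by auto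
qed

lemma join_cover_refines:
  assumes ref: "\<And>W. W \<in> \<W> \<Longrightarrow> \<exists>U\<in>\<U>. W \<subseteq> U" and W: "W \<in> join_cover \<gamma> F \<W>"
  shows "\<exists>U\<in>join_cover \<gamma> F \<U>. W \<subseteq> U"
proof -
  obtain f where f: "\<And>W. W \<in> \<W> \<Longrightarrow> f W \<in> \<U> \<and> W \<subseteq> f W"
    using ref by metis
  obtain V where V: "W = (\<Inter>s\<in>F. \<gamma> s -` V s)" "\<forall>s\<in>F. V s \<in> \<W>"
    using W unfolding join_cover_def by blast
  have "(\<Inter>s\<in>F. \<gamma> s -` f (V s)) \<in> join_cover \<gamma> F \<U>"
    unfolding join_cover_def using V f by (intro CollectI exI[of _ "\<lambda>s. f (V s)"]) auto
  moreover have "W \<subseteq> (\<Inter>s\<in>F. \<gamma> s -` f (V s))"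
    unfolding V(1) using V(2) f by blast
  ultimately show ?thesis by blast
qed

lemma min_subcover_card_join_Un:
  fixes \<gamma> :: "'s \<Rightarrow> 'c \<Rightarrow> 'c::topological_space"
  assumes comp: "compact (UNIV :: 'c set)" and cont: "\<And>s. continuous_on UNIV (\<gamma> s)"
    and \<U>: "open_cover \<U>" and A: "finite A" and B: "finite B"
  shows "min_subcover_card (join_cover \<gamma> (A \<union> B) \<U>)
    \<le> min_subcover_card (join_cover \<gamma> A \<U>) * min_subcover_card (join_cover \<gamma> B \<U>)"
proof -
  obtain \<V> where \<V>: "\<V> \<subseteq> join_cover \<gamma> A \<U>" "finite \<V>" "\<Union>\<V> = UNIV"
    "card \<V> = min_subcover_card (join_cover \<gamma> A \<U>)"
    using min_subcover[OF comp open_cover_join[OF cont \<U> A]] .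
  obtain \<W> where \<W>: "\<W> \<subseteq> join_cover \<gamma> B \<U>" "finite \<W>" "\<Union>\<W> = UNIV"
    "card \<W> = min_subcover_card (join_cover \<gamma> B \<U>)"
    using min_subcover[OF comp open_cover_join[OF cont \<U> B]] .
  let ?J = "(\<lambda>(V, W). V \<inter> W) ` (\<V> \<times> \<W>)"
  have "min_subcover_card (join_cover \<gamma> (A \<union> B) \<U>) \<le> card ?J"
  proof (rule min_subcover_card_le)
    show "finite ?J" using \<V> \<W> by simp
    show "\<Union>?J = UNIV"
    proof -
      have "\<Union>?J = \<Union>\<V> \<inter> \<Union>\<W>" by auto
      then show ?thesis using \<V>(3) \<W>(3) by simp
    qed
    fix J assume "J \<in> ?J"
    then obtain V W where J: "J = V \<inter> W" "V \<in> \<V>" "W \<in> \<W>" by auto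
    obtain f where f: "V = (\<Inter>s\<in>A. \<gamma> s -` f s)" "\<forall>s\<in>A. f s \<in> \<U>"
      using J(2) \<V>(1) unfolding join_cover_def by blast
    obtain g where g: "W = (\<Inter>s\<in>B. \<gamma> s -` g s)" "\<forall>s\<in>B. g s \<in> \<U>"
      using J(3) \<W>(1) unfolding join_cover_def by blast
    \<comment> \<open>On \<open>A \<inter> B\<close> the members chosen by \<open>f\<close> and
      \<open>g\<close> may differ; dropping that of \<open>g\<close> only enlarges the set, and a
      refinement is enough.\<close>
    define k where "k s = (if s \<in> A then f s else g s)" for s
    have "(\<Inter>s\<in>A \<union> B. \<gamma> s -` k s) \<in> join_cover \<gamma> (A \<union> B) \<U>"
      unfolding join_cover_def using f(2) g(2) by (intro CollectI exI[of _ k]) (auto simp: k_def)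
    moreover have "J \<subseteq> (\<Inter>s\<in>A \<union> B. \<gamma> s -` k s)"
      unfolding J(1) f(1) g(1) by (auto simp: k_def)
    ultimately show "\<exists>U\<in>join_cover \<gamma> (A \<union> B) \<U>. J \<subseteq> U" by blast
  qed
  also have "\<dots> \<le> card (\<V> \<times> \<W>)"
    using \<V> \<W> by (intro card_image_le) auto
  finally show ?thesis using \<V> \<W> by (simp add: card_cartesian_product)
qed

text \<open>Pulling a minimal subcover for \<open>A\<close> back along \<open>\<gamma> s\<close>
  refines the join over the translate, since
  \<open>\<gamma> (a * s) = \<gamma> a \<circ> \<gamma> s\<close>. Distinct members may have equal
  preimages.\<close>

lemma min_subcover_card_join_translate:
  fixes \<gamma> :: "'s::monoid_mult \<Rightarrow> 'c \<Rightarrow> 'c::topological_space"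
  assumes canc: "cancellative TYPE('s)"
    and comp: "compact (UNIV :: 'c set)" and cont: "\<And>s. continuous_on UNIV (\<gamma> s)"
    and act: "left_action \<gamma>" and \<U>: "open_cover \<U>" and A: "finite A"
  shows "min_subcover_card (join_cover \<gamma> ((\<lambda>x. x * s) ` A) \<U>) \<le> min_subcover_card (join_cover \<gamma> A \<U>)"
proof -
  obtain \<V> where \<V>: "\<V> \<subseteq> join_cover \<gamma> A \<U>" "finite \<V>" "\<Union>\<V> = UNIV"
    "card \<V> = min_subcover_card (join_cover \<gamma> A \<U>)"
    using min_subcover[OF comp open_cover_join[OF cont \<U> A]] .
  have inj: "inj_on (\<lambda>x. x * s) A"
    using canc unfolding cancellative_def by (metis inj_on_subset subset_UNIV)
  let ?J = "(\<lambda>V. \<gamma> s -` V) ` \<V>"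
  have "min_subcover_card (join_cover \<gamma> ((\<lambda>x. x * s) ` A) \<U>) \<le> card ?J"
  proof (rule min_subcover_card_le)
    show "finite ?J" using \<V> by simp
    show "\<Union>?J = UNIV" using \<V>(3) by (simp flip: vimage_Union)
    fix J assume "J \<in> ?J"
    then obtain V where J: "J = \<gamma> s -` V" "V \<in> \<V>" by auto
    obtain f where f: "V = (\<Inter>a\<in>A. \<gamma> a -` f a)" "\<forall>a\<in>A. f a \<in> \<U>"
      using J(2) \<V>(1) unfolding join_cover_def by blast
    \<comment> \<open>Injectivity of right multiplication lets the choice of cover members be
      carried from \<open>A\<close> to its translate.\<close>
    define k where "k b = f (inv_into A (\<lambda>x. x * s) b)" for b
    have k: "k (a * s) = f a" if "a \<in> A" for a
      unfolding k_def using inv_into_f_f[OF inj that] by simp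
    have "(\<Inter>b\<in>(\<lambda>x. x * s) ` A. \<gamma> b -` k b) \<in> join_cover \<gamma> ((\<lambda>x. x * s) ` A) \<U>"
      unfolding join_cover_def using f(2) k by (intro CollectI exI[of _ k]) auto
    moreover have "J \<subseteq> (\<Inter>b\<in>(\<lambda>x. x * s) ` A. \<gamma> b -` k b)"
      using act unfolding J(1) f(1) by (auto simp: k left_action_def)
    ultimately show "\<exists>U\<in>join_cover \<gamma> ((\<lambda>x. x * s) ` A) \<U>. J \<subseteq> U" by blast
  qed
  also have "\<dots> \<le> card \<V>" using \<V> by (intro card_image_le) auto
  finally show ?thesis using \<V> by simp
qed

lemma subadditive_join_cover:
  fixes \<gamma> :: "'s::monoid_mult \<Rightarrow> 'c \<Rightarrow> 'c::topological_space"
  assumes canc: "cancellative TYPE('s)"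
    and comp: "compact (UNIV :: 'c set)" and cont: "\<And>s. continuous_on UNIV (\<gamma> s)"
    and act: "left_action \<gamma>" and \<U>: "open_cover \<U>"
  shows "subadditive_set_function (\<lambda>F. ln (real (min_subcover_card (join_cover \<gamma> F \<U>))))"
proof
  have pos: "0 < min_subcover_card (join_cover \<gamma> A \<U>)" if "finite A" for A
    by (rule min_subcover_card_pos[OF comp open_cover_join[OF cont \<U> that]])
  show "cancellative TYPE('s)" by fact
  show "0 \<le> ln (real (min_subcover_card (join_cover \<gamma> A \<U>)))" if "finite A" for A
    using pos[OF that] by (simp add: Suc_le_eq)
  have "min_subcover_card {UNIV :: 'c set} = 1"
    using min_subcover_card_partition[of "{UNIV :: 'c set}"] by simp
  then show "ln (real (min_subcover_card (join_cover \<gamma> {} \<U>))) = 0"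
    by (simp add: join_cover_empty)
  show "ln (real (min_subcover_card (join_cover \<gamma> (A \<union> B) \<U>)))
      \<le> ln (real (min_subcover_card (join_cover \<gamma> A \<U>))) + ln (real (min_subcover_card (join_cover \<gamma> B \<U>)))"
    if "finite A" "finite B" for A B
  proof -
    have "ln (real (min_subcover_card (join_cover \<gamma> (A \<union> B) \<U>)))
        \<le> ln (real (min_subcover_card (join_cover \<gamma> A \<U>) * min_subcover_card (join_cover \<gamma> B \<U>)))"
      using min_subcover_card_join_Un[OF comp cont \<U> that] pos[of "A \<union> B"] that
      by (intro ln_mono) (auto simp del: of_nat_mult)
    then show ?thesis
      using pos that by (simp add: ln_mult)
  qed
  show "ln (real (min_subcover_card (join_cover \<gamma> ((\<lambda>x. x * s) ` A) \<U>)))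
      \<le> ln (real (min_subcover_card (join_cover \<gamma> A \<U>)))" if "finite A" for A s
    using min_subcover_card_join_translate[OF canc comp cont act \<U> that] pos[of "(\<lambda>x. x * s) ` A"] that
    by (intro ln_mono) auto
qed


section \<open>Trajectories\<close>

lemma card_set_plus_le:
  fixes A B :: "'a::ab_group_add set"
  assumes "finite A" "finite B"
  shows "card (A + B) \<le> card A * card B"
  unfolding set_plus_image using card_image_le[of "A \<times> B"] assms
  by (simp add: card_cartesian_product)

lemma card_le_card_set_plus:
  fixes A B :: "'a::ab_group_add set"
  assumes "finite A" "finite B" "B \<noteq> {}"
  shows "card A \<le> card (A + B)"
proof -
  obtain b where b: "b \<in> B" using assms by blast
  have "card A = card ((\<lambda>a. a + b) ` A)"
    by (simp add: card_image)
  also have "\<dots> \<le> card (A + B)"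
    using b assms by (intro card_mono finite_set_plus) (auto intro: set_plus_intro)
  finally show ?thesis .
qed

lemma additive_image_set_plus:
  assumes "Modules.additive f"
  shows "f ` (A + B) = f ` A + f ` B"
proof -
  interpret Modules.additive f by fact
  show ?thesis by (force simp: set_plus_def add)
qed

lemma trajectory_empty: "trajectory \<beta> {} X = {0}"
  by (simp add: trajectory_def set_zero)

lemma trajectory_insert:
  "finite F \<Longrightarrow> s \<notin> F \<Longrightarrow> trajectory \<beta> (insert s F) X = \<beta> s ` X + trajectory \<beta> F X"
  by (simp add: trajectory_def)

lemma trajectory_Un_disjoint:
  "finite E \<Longrightarrow> finite F \<Longrightarrow> E \<inter> F = {} \<Longrightarrow>
    trajectory \<beta> (E \<union> F) X = trajectory \<beta> E X + trajectory \<beta> F X"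
  by (simp add: trajectory_def sum.union_disjoint)

lemma finite_trajectory: "finite F \<Longrightarrow> finite X \<Longrightarrow> finite (trajectory \<beta> F X)"
  by (induction F rule: finite_induct) (simp_all add: trajectory_empty trajectory_insert finite_set_plus)

lemma trajectory_nonempty: "finite F \<Longrightarrow> X \<noteq> {} \<Longrightarrow> trajectory \<beta> F X \<noteq> {}"
proof (induction F rule: finite_induct)
  case (insert s F)
  then obtain x y where "x \<in> X" "y \<in> trajectory \<beta> F X" by blast
  then have "\<beta> s x + y \<in> trajectory \<beta> (insert s F) X"
    using insert by (simp add: trajectory_insert set_plus_intro)
  then show ?case by blast
qed (simp add: trajectory_empty)

lemma trajectory_mono: "finite F \<Longrightarrow> X \<subseteq> Y \<Longrightarrow> trajectory \<beta> F X \<subseteq> trajectory \<beta> F Y"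
  by (induction F rule: finite_induct)
    (simp_all add: trajectory_empty trajectory_insert set_plus_mono2 image_mono)

text \<open>In a right action, right translation applies the one map \<open>\<beta> s\<close> to all
  summands at once; right cancellation keeps the summands from merging.\<close>

lemma trajectory_translate:
  assumes canc: "cancellative TYPE('s::monoid_mult)"
    and act: "right_action \<beta>" and add: "\<And>s. Modules.additive (\<beta> s)" and F: "finite F"
  shows "trajectory \<beta> ((\<lambda>x. x * s) ` F) X = \<beta> (s :: 's) ` trajectory \<beta> F X"
  using F
proof (induction F rule: finite_induct)
  case empty
  interpret Modules.additive "\<beta> s" by (rule add)
  show ?case by (simp add: trajectory_empty zero)
next
  case (insert a F)
  have inj: "inj (\<lambda>x. x * s)"
    using canc unfolding cancellative_def by blast
  have "a * s \<notin> (\<lambda>x. x * s) ` F"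
    using inj_image_mem_iff[OF inj, of a F] insert(2) by simp
  moreover have "\<beta> (a * s) ` X = \<beta> s ` \<beta> a ` X"
    using act by (simp add: right_action_def image_comp)
  ultimately show ?case
    using insert by (simp add: trajectory_insert additive_image_set_plus[OF add])
qed

lemma subadditive_trajectory:
  fixes \<beta> :: "'s::monoid_mult \<Rightarrow> 'a \<Rightarrow> 'a::ab_group_add"
  assumes canc: "cancellative TYPE('s)"
    and act: "right_action \<beta>" and add: "\<And>s. Modules.additive (\<beta> s)"
    and X: "finite X" "X \<noteq> {}"
  shows "subadditive_set_function (\<lambda>F. ln (real (card (trajectory \<beta> F X))))"
proof
  have pos: "0 < card (trajectory \<beta> A X)" if "finite A" for A
    using trajectory_nonempty[OF that X(2)] finite_trajectory[OF that X(1)] by (simp add: card_gt_0_iff)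
  show "cancellative TYPE('s)" by fact
  show "0 \<le> ln (real (card (trajectory \<beta> A X)))" if "finite A" for A
    using pos[OF that] by (simp add: Suc_le_eq)
  show "ln (real (card (trajectory \<beta> {} X))) = 0"
    by (simp add: trajectory_empty)
  show "ln (real (card (trajectory \<beta> (A \<union> B) X)))
      \<le> ln (real (card (trajectory \<beta> A X))) + ln (real (card (trajectory \<beta> B X)))"
    if A: "finite A" and B: "finite B" for A B
  proof -
    \<comment> \<open>A sum over \<open>A \<union> B\<close> counts the indices in
      \<open>A \<inter> B\<close> once, so the union is first made disjoint. Going back from
      \<open>B - A\<close> to \<open>B\<close> adds a nonempty set, which cannot lower the
      cardinality.\<close>
    have "card (trajectory \<beta> (A \<union> B) X) = card (trajectory \<beta> A X + trajectory \<beta> (B - A) X)"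
      using trajectory_Un_disjoint[of A "B - A" \<beta> X] A B by simp
    also have "\<dots> \<le> card (trajectory \<beta> A X) * card (trajectory \<beta> (B - A) X)"
      using A B X by (intro card_set_plus_le finite_trajectory) auto
    finally have "card (trajectory \<beta> (A \<union> B) X)
        \<le> card (trajectory \<beta> A X) * card (trajectory \<beta> (B - A) X)" .
    moreover have "card (trajectory \<beta> (B - A) X) \<le> card (trajectory \<beta> B X)"
    proof -
      have "card (trajectory \<beta> (B - A) X) \<le> card (trajectory \<beta> (B - A) X + trajectory \<beta> (B \<inter> A) X)"
        using A B X by (intro card_le_card_set_plus finite_trajectory trajectory_nonempty) auto
      also have "trajectory \<beta> (B - A) X + trajectory \<beta> (B \<inter> A) X = trajectory \<beta> ((B - A) \<union> (B \<inter> A)) X"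
        using A B by (subst trajectory_Un_disjoint) auto
      also have "(B - A) \<union> (B \<inter> A) = B" by auto
      finally show ?thesis .
    qed
    ultimately have "card (trajectory \<beta> (A \<union> B) X) \<le> card (trajectory \<beta> A X) * card (trajectory \<beta> B X)"
      by (meson mult_le_mono2 order_trans)
    then have "ln (real (card (trajectory \<beta> (A \<union> B) X)))
        \<le> ln (real (card (trajectory \<beta> A X) * card (trajectory \<beta> B X)))"
      using pos[of "A \<union> B"] A B by (intro ln_mono) (auto simp del: of_nat_mult)
    then show ?thesis
      using pos A B by (simp add: ln_mult)
  qed
  show "ln (real (card (trajectory \<beta> ((\<lambda>x. x * s) ` A) X))) \<le> ln (real (card (trajectory \<beta> A X)))"
    if "finite A" for A s
    using pos[of "(\<lambda>x. x * s) ` A"] that card_image_le[OF finite_trajectory[OF that X(1)], of "\<beta> s"]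
    unfolding trajectory_translate[OF canc act add that] by (intro ln_mono) auto
qed


section \<open>Open subgroups and characters\<close>

text \<open>In a compact Hausdorff space the quasicomponent of \<open>a\<close>, the intersection of
  all clopen sets containing \<open>a\<close>, is connected. Here it is therefore a point, and by
  compactness some clopen set fits into \<open>W\<close>.\<close>

lemma clopen_nhds_base:
  fixes W :: "'k::t2_space set"
  assumes comp: "compact (UNIV :: 'k set)" and td: "totally_disconnected (UNIV :: 'k set)"
    and W: "open W" "a \<in> W"
  obtains U where "open U" "closed U" "a \<in> U" "U \<subseteq> W"
proof -
  define \<T> where "\<T> = {T. open T \<and> closed T \<and> a \<in> T}"
  \<comment> \<open>\<open>\<T>\<close> is closed under finite intersections, so the finite
    intersection property on the compact set \<open>- V\<close> yields a single member.\<close>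
  have sub: "\<exists>T\<in>\<T>. T \<subseteq> V" if V: "open V" "\<Inter>\<T> \<subseteq> V" for V
  proof -
    have "compact (- V)"
      using V comp by (metis Compl_eq_Diff_UNIV compact_diff)
    moreover have "- V \<inter> \<Inter>\<T> = {}"
      using V by auto
    ultimately obtain \<F> where \<F>: "finite \<F>" "\<F> \<subseteq> \<T>" "- V \<inter> \<Inter>\<F> = {}"
      using compact_imp_fip[of "- V" \<T>] unfolding \<T>_def by blast
    then have "\<Inter>\<F> \<in> \<T>"
      unfolding \<T>_def by (auto intro!: open_Inter closed_Inter)
    then show ?thesis
      using \<F>(3) by blast
  qed
  have closedQ: "closed (\<Inter>\<T>)"
    unfolding \<T>_def by (auto intro!: closed_Inter)
  have aQ: "a \<in> \<Inter>\<T>"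
    unfolding \<T>_def by auto
  \<comment> \<open>Separate the pieces by disjoint open sets and take \<open>T \<in> \<T>\<close>
    inside their union. The part of \<open>T\<close> in \<open>V1\<close> is again clopen and
    contains \<open>a\<close>, so it contains the whole quasicomponent.\<close>
  have no_split: "K2 = {}"
    if K: "closed K1" "closed K2" "K1 \<inter> K2 = {}" "K1 \<union> K2 = \<Inter>\<T>" "a \<in> K1" for K1 K2
  proof -
    have "compact K1" "compact K2"
      using K comp compact_Int_closed[of UNIV] by auto
    moreover have "Hausdorff_space (euclidean :: 'k topology)"
      unfolding Hausdorff_space_def by (metis disjnt_def hausdorff open_openin)
    ultimately obtain V1 V2 where V: "open V1" "open V2" "K1 \<subseteq> V1" "K2 \<subseteq> V2" "V1 \<inter> V2 = {}"
      using Hausdorff_space_compact_separation[of euclidean K1 K2] K(3)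
      by (auto simp: disjnt_def)
    then obtain T where T: "T \<in> \<T>" "T \<subseteq> V1 \<union> V2"
      using sub[of "V1 \<union> V2"] K(4) by blast
    have "T \<inter> V1 = T - V2"
      using T(2) V(5) by auto
    moreover have "open (T \<inter> V1)" "closed (T - V2)" "a \<in> T \<inter> V1"
      using T(1) V K(5) unfolding \<T>_def by auto
    ultimately have "T \<inter> V1 \<in> \<T>"
      unfolding \<T>_def by simp
    then show ?thesis
      using K(4) V(4,5) by blast
  qed
  have "connected (\<Inter>\<T>)"
    unfolding connected_closed
  proof clarify
    fix A B
    assume AB: "closed A" "closed B" "\<Inter>\<T> \<subseteq> A \<union> B" "A \<inter> B \<inter> \<Inter>\<T> = {}"
      "A \<inter> \<Inter>\<T> \<noteq> {}" "B \<inter> \<Inter>\<T> \<noteq> {}"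
    have cl: "closed (A \<inter> \<Inter>\<T>)" "closed (B \<inter> \<Inter>\<T>)"
      using AB closedQ by auto
    have un: "(A \<inter> \<Inter>\<T>) \<union> (B \<inter> \<Inter>\<T>) = \<Inter>\<T>" "(A \<inter> \<Inter>\<T>) \<inter> (B \<inter> \<Inter>\<T>) = {}"
      using AB(3,4) by blast+
    show False
    proof (cases "a \<in> A \<inter> \<Inter>\<T>")
      case True
      then show False
        using no_split[OF cl un(2,1)] AB(6) by blast
    next
      case False
      then have "a \<in> B \<inter> \<Inter>\<T>"
        using aQ un(1) by blast
      then show False
        using no_split[OF cl(2,1)] un AB(5) by blast
    qed
  qed
  then obtain x where "\<Inter>\<T> \<subseteq> {x}"
    using td unfolding totally_disconnected_def by blast
  then have "\<Inter>\<T> \<subseteq> W"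
    using aQ W(2) by blast
  then obtain T where "T \<in> \<T>" "T \<subseteq> W"
    using sub[OF W(1)] by blast
  then show ?thesis
    using that unfolding \<T>_def by blast
qed

definition add_subgroup :: "'a::ab_group_add set \<Rightarrow> bool"
  where "add_subgroup V \<longleftrightarrow> 0 \<in> V \<and> (\<forall>x\<in>V. \<forall>y\<in>V. x + y \<in> V) \<and> (\<forall>x\<in>V. - x \<in> V)"

text \<open>The stabiliser of a clopen neighbourhood \<open>U\<close> of \<open>0\<close> under
  translation is a subgroup. It lies in \<open>U\<close> because it moves \<open>0\<close> within
  \<open>U\<close>, and it is open by the tube lemma because \<open>U\<close> is compact.\<close>

lemma open_subgroup_base:
  fixes W :: "'k::{topological_ab_group_add, t2_space} set"
  assumes comp: "compact (UNIV :: 'k set)" and td: "totally_disconnected (UNIV :: 'k set)"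
    and W: "open W" "0 \<in> W"
  obtains V where "open V" "add_subgroup V" "V \<subseteq> W"
proof -
  obtain U where U: "open U" "closed U" "0 \<in> U" "U \<subseteq> W"
    using clopen_nhds_base[OF comp td W] by blast
  define V where "V = {v. \<forall>u\<in>U. u + v \<in> U \<and> u - v \<in> U}"
  have "compact U"
    using U comp compact_Int_closed[of UNIV] by auto
  let ?S = "{p :: 'k \<times> 'k. snd p + fst p \<in> U \<and> snd p - fst p \<in> U}"
  have "?S = ((\<lambda>p. snd p + fst p) -` U) \<inter> ((\<lambda>p. snd p - fst p) -` U)"
    by auto
  moreover have "open ((\<lambda>p :: 'k \<times> 'k. snd p + fst p) -` U)"
    "open ((\<lambda>p :: 'k \<times> 'k. snd p - fst p) -` U)"
    using U(1) by (intro open_vimage continuous_intros; simp)+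
  ultimately have opS: "open ?S" by (simp add: open_Int)
  have "open V"
  proof (subst open_subopen, intro ballI)
    fix v assume "v \<in> V"
    then have "{v} \<times> U \<subseteq> ?S" unfolding V_def by auto
    then obtain X where "v \<in> X" "open X" "X \<times> U \<subseteq> ?S"
      using Elementary_Topology.tube_lemma[OF \<open>compact U\<close> opS] by blast
    then show "\<exists>T. open T \<and> v \<in> T \<and> T \<subseteq> V"
      unfolding V_def by (intro exI[of _ X]) force
  qed
  moreover have "add_subgroup V"
    unfolding add_subgroup_def V_def by (auto simp: algebra_simps) (metis diff_diff_add)
  moreover have "V \<subseteq> W"
    using U(3,4) unfolding V_def by force
  ultimately show ?thesis by (rule that)
qed

text \<open>The class \<^class>\<open>ab_group_add\<close> has no multiplication by natural numbers.\<close>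

definition nat_mult :: "nat \<Rightarrow> 'a::ab_group_add \<Rightarrow> 'a"
  where "nat_mult n x = ((+) x ^^ n) 0"

lemma nat_mult_0 [simp]: "nat_mult 0 x = 0"
  by (simp add: nat_mult_def)

lemma nat_mult_Suc [simp]: "nat_mult (Suc n) x = x + nat_mult n x"
  by (simp add: nat_mult_def)

lemma nat_mult_add: "nat_mult (m + n) x = nat_mult m x + nat_mult n x"
  by (induction m) (simp_all add: add.assoc)

lemma add_subgroup_diff: "add_subgroup V \<Longrightarrow> x \<in> V \<Longrightarrow> y \<in> V \<Longrightarrow> x - y \<in> V"
  unfolding add_subgroup_def by (metis diff_conv_add_uminus)

lemma open_coset:
  fixes V :: "'k::topological_ab_group_add set"
  assumes "open V"
  shows "open {y. y - x \<in> V}"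
proof -
  have "{y. y - x \<in> V} = (\<lambda>y. y - x) -` V" by auto
  then show ?thesis using assms by (simp add: open_vimage continuous_intros)
qed

section \<open>Finite index of open subgroups\<close>

lemma open_subgroup_finite_index:
  fixes V :: "'k::topological_ab_group_add set"
  assumes comp: "compact (UNIV :: 'k set)" and V: "open V" "add_subgroup V"
  obtains R where "finite R" "\<And>x. \<exists>r\<in>R. x - r \<in> V"
proof -
  have "UNIV \<subseteq> (\<Union>r\<in>UNIV. {y. y - r \<in> V})"
    using V(2) by (auto simp: add_subgroup_def)
  then obtain R where "R \<subseteq> UNIV" "finite R" "UNIV \<subseteq> (\<Union>r\<in>R. {y. y - r \<in> V})"
    using compactE_image[OF comp, of UNIV "\<lambda>r. {y. y - r \<in> V}"] open_coset[OF V(1)] by blast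
  then show ?thesis using that[of R] by blast
qed

text \<open>Two different multiples of \<open>x\<close> lie in the same of the finitely many cosets;
  their difference is the required multiple.\<close>

lemma nat_mult_in_open_subgroup:
  fixes V :: "'k::topological_ab_group_add set"
  assumes comp: "compact (UNIV :: 'k set)" and V: "open V" "add_subgroup V"
  obtains n where "0 < n" "nat_mult n x \<in> V"
proof -
  obtain R where R: "finite R" "\<And>x. \<exists>r\<in>R. x - r \<in> V"
    using open_subgroup_finite_index[OF assms] by metis
  obtain f where f: "\<And>x. f x \<in> R \<and> x - f x \<in> V" using R(2) by metis
  have "finite (range (\<lambda>n. f (nat_mult n x)))"
    using f by (intro finite_subset[OF _ R(1)]) auto
  then have "\<not> inj (\<lambda>n. f (nat_mult n x))"
    using finite_imageD[of "\<lambda>n. f (nat_mult n x)" UNIV] by auto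
  then obtain m n where mn: "m < n" "f (nat_mult m x) = f (nat_mult n x)"
    unfolding inj_def by (metis linorder_neqE_nat)
  have "(nat_mult n x - f (nat_mult n x)) - (nat_mult m x - f (nat_mult m x)) \<in> V"
    by (rule add_subgroup_diff[OF V(2) conjunct2[OF f] conjunct2[OF f]])
  moreover have "nat_mult n x = nat_mult (n - m) x + nat_mult m x"
    using mn(1) nat_mult_add[of "n - m" m x] by simp
  ultimately have "nat_mult (n - m) x \<in> V" using mn(2) by simp
  then show ?thesis using that[of "n - m"] mn(1) by simp
qed

section \<open>Characters as eigenfunctions of translations\<close>

text \<open>The mechanism of character orthogonality, applied below to roots of unity, to classes of
  points and to groups of characters.\<close>

lemma sum_zero_if_eigen_shift:
  fixes f :: "'b \<Rightarrow> complex"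
  assumes "bij_betw p A A" and "\<And>a. a \<in> A \<Longrightarrow> f (p a) = z * f a" and "z \<noteq> 1"
  shows "sum f A = 0"
proof -
  have "sum f A = (\<Sum>a\<in>A. f (p a))"
    using sum.reindex_bij_betw[OF assms(1), of f] by simp
  also have "\<dots> = z * sum f A"
    using assms(2) by (simp add: sum_distrib_left)
  finally show ?thesis using assms(3) by simp
qed

lemma sum_powers_roots_unity:
  fixes n :: nat
  assumes "j < n"
  shows "(\<Sum>z | z ^ n = (1::complex). z ^ j) = (if j = 0 then of_nat n else 0)"
proof (cases "j = 0")
  case True
  then show ?thesis using assms card_roots_unity_eq[of n] by simp
next
  case False
  \<comment> \<open>A primitive \<open>n\<close>-th root of unity, so that
    \<open>w ^ j \<noteq> 1\<close> for \<open>0 < j < n\<close>.\<close>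
  define w where "w = exp (2 * of_real pi * \<i> * of_nat 1 / of_nat n)"
  have w: "w ^ n = 1"
    using complex_root_unity[of n 1] assms by (simp add: w_def)
  have "w ^ j = exp (2 * of_real pi * \<i> * of_nat j / of_nat n)"
    unfolding w_def by (simp add: mult_ac flip: exp_of_nat_mult)
  moreover have "exp (2 * of_real pi * \<i> * of_nat j / of_nat n) \<noteq> 1"
    using complex_root_unity_eq_1[of n j] assms False by (auto dest: dvd_imp_le)
  ultimately have wj: "w ^ j \<noteq> 1" by simp
  have "w \<noteq> 0" by (simp add: w_def)
  have "bij_betw ((*) w) {z. z ^ n = 1} {z. z ^ n = 1}"
    by (rule bij_betwI[of _ _ _ "\<lambda>z. z / w"]) (use w \<open>w \<noteq> 0\<close> in \<open>auto simp: power_mult_distrib power_divide\<close>)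
  then have "(\<Sum>z | z ^ n = (1::complex). z ^ j) = 0"
    by (rule sum_zero_if_eigen_shift[OF _ _ wj]) (auto simp: power_mult_distrib)
  then show ?thesis using False by simp
qed

text \<open>
  The characters of a group that are trivial on a subgroup of finite index are obtained as joint
  eigenfunctions of the translations: the translation by \<open>y\<close> acts with finite order on the
  invariant functions, so that projecting to its eigenspaces is possible.
\<close>

lemma eigenfunction_step:
  fixes f :: "'a::ab_group_add \<Rightarrow> complex"
  assumes n: "0 < n" and inv: "\<And>x. f (x + nat_mult n y) = f x" and nz: "f x0 \<noteq> 0"
  shows "\<exists>g z. (\<forall>x. g (x + y) = z * g x) \<and> (\<exists>x. g x \<noteq> 0) \<and>
    (\<forall>u c. (\<forall>x. f (x + u) = c * f x) \<longrightarrow> (\<forall>x. g (x + u) = c * g x)) \<and>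
    ((\<exists>x. f (x + y) \<noteq> f x) \<longrightarrow> z \<noteq> 1)"
proof -
  \<comment> \<open>Up to the factor \<open>n\<close>, the spectral projection of \<open>f\<close>
    for the eigenvalue \<open>z\<close> of the translation by \<open>y\<close>.\<close>
  define P where "P z x = (\<Sum>j<n. inverse z ^ j * f (x + nat_mult j y))" for z x
  let ?Z = "{z::complex. z ^ n = 1}"
  have finZ: "finite ?Z" using n by (intro finite_roots_unity) simp
  have eig: "P z (x + y) = z * P z x" if z: "z \<in> ?Z" for z x
  proof -
    have "z \<noteq> 0" using z n by (auto simp: power_0_left)
    define g where "g j = inverse z ^ j * f (x + nat_mult j y)" for j
    have "P z (x + y) = (\<Sum>j<n. z * g (Suc j))"
      unfolding P_def g_def using \<open>z \<noteq> 0\<close> by (intro sum.cong) (simp_all add: add.assoc)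
    also have "\<dots> = z * (\<Sum>j<n. g (Suc j))" by (simp add: sum_distrib_left)
    also have "(\<Sum>j<n. g (Suc j)) = (\<Sum>j<n. g j)"
    proof -
      have "g n = g 0" using z inv by (simp add: g_def power_inverse)
      moreover have "g 0 + (\<Sum>j<n. g (Suc j)) = (\<Sum>j<n. g j) + g n"
        by (metis sum.lessThan_Suc sum.lessThan_Suc_shift)
      ultimately show ?thesis by simp
    qed
    finally show ?thesis by (simp add: P_def g_def)
  qed
  \<comment> \<open>Fourier inversion on the cyclic group of order \<open>n\<close>: the projections
    add up to \<open>n\<close> times \<open>f\<close>, so they cannot all vanish.\<close>
  have total: "(\<Sum>z\<in>?Z. P z x) = of_nat n * f x" for x
  proof -
    have bij: "bij_betw inverse ?Z ?Z"
      by (rule bij_betwI[of _ _ _ inverse]) (auto simp: power_inverse)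
    have "(\<Sum>z\<in>?Z. P z x) = (\<Sum>j<n. (\<Sum>z\<in>?Z. inverse z ^ j) * f (x + nat_mult j y))"
      unfolding P_def by (subst sum.swap) (simp add: sum_distrib_right)
    also have "\<dots> = (\<Sum>j<n. (if j = 0 then of_nat n else 0) * f (x + nat_mult j y))"
    proof (intro sum.cong refl)
      fix j assume "j \<in> {..<n}"
      then have "(\<Sum>z\<in>?Z. inverse z ^ j) = (if j = 0 then of_nat n else 0)"
        using sum.reindex_bij_betw[OF bij, of "\<lambda>z. z ^ j"] sum_powers_roots_unity[of j n] by simp
      then show "(\<Sum>z\<in>?Z. inverse z ^ j) * f (x + nat_mult j y) =
          (if j = 0 then of_nat n else 0) * f (x + nat_mult j y)" by simp
    qed
    also have "\<dots> = (\<Sum>j\<in>{0}. of_nat n * f (x + nat_mult j y))"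
      using n by (intro sum.mono_neutral_cong_right) auto
    finally show ?thesis by simp
  qed
  \<comment> \<open>Translations commute, so the projection keeps every eigenvalue that
    \<open>f\<close> already has.\<close>
  have pres: "P z (x + u) = c * P z x" if "\<And>x. f (x + u) = c * f x" for z x u c
  proof -
    have "f (x + u + nat_mult j y) = c * f (x + nat_mult j y)" for j
      using that[of "x + nat_mult j y"] by (simp add: add_ac)
    then show ?thesis by (simp add: P_def sum_distrib_left mult_ac)
  qed
  \<comment> \<open>A nontrivial eigenvalue is preferred. If none occurs, \<open>f\<close> is
    proportional to \<open>P 1\<close> and hence invariant under \<open>y\<close>, which makes the
    last clause vacuous.\<close>
  show ?thesis
  proof (cases "\<exists>z\<in>?Z. z \<noteq> 1 \<and> (\<exists>x. P z x \<noteq> 0)")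
    case True
    then obtain z where "z \<in> ?Z" "z \<noteq> 1" "\<exists>x. P z x \<noteq> 0" by blast
    then show ?thesis
      using eig pres by (intro exI[of _ "P z"] exI[of _ z]) auto
  next
    case False
    have "1 \<in> ?Z" by simp
    have P1: "P 1 x = of_nat n * f x" for x
    proof -
      have "(\<Sum>z\<in>?Z. P z x) = (\<Sum>z\<in>{1}. P z x)"
        using False finZ by (intro sum.mono_neutral_right) auto
      then show ?thesis using total by simp
    qed
    then have "f (x + y) = f x" for x
      using eig[OF \<open>1 \<in> ?Z\<close>, of x] n by simp
    moreover have "P 1 x0 \<noteq> 0" using P1 n nz by simp
    ultimately show ?thesis
      using eig[OF \<open>1 \<in> ?Z\<close>] pres by (intro exI[of _ "P 1"] exI[of _ 1]) auto
  qed
qed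

text \<open>One translation is diagonalised at a time. The last clause carries along the earlier
  eigenvalues; with eigenvalue \<open>1\<close> it also carries the \<open>V\<close>-invariance that
  gives each further translation finite order.\<close>

lemma joint_eigenfunction:
  fixes f :: "'a::ab_group_add \<Rightarrow> complex"
  assumes R: "finite R" and V: "\<And>y. \<exists>n>0. nat_mult n y \<in> V"
    and inv: "\<And>x v. v \<in> V \<Longrightarrow> f (x + v) = f x" and nz: "\<exists>x. f x \<noteq> 0"
  shows "\<exists>g. (\<exists>x. g x \<noteq> 0) \<and> (\<forall>r\<in>R. \<exists>c. \<forall>x. g (x + r) = c * g x) \<and>
    (\<forall>u c. (\<forall>x. f (x + u) = c * f x) \<longrightarrow> (\<forall>x. g (x + u) = c * g x))"
  using R
proof (induction R rule: finite_induct)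
  case empty
  then show ?case using nz by (intro exI[of _ f]) auto
next
  case (insert r R)
  then obtain g where g: "\<exists>x. g x \<noteq> 0" "\<forall>r\<in>R. \<exists>c. \<forall>x. g (x + r) = c * g x"
    "\<forall>u c. (\<forall>x. f (x + u) = c * f x) \<longrightarrow> (\<forall>x. g (x + u) = c * g x)" by blast
  obtain n where n: "0 < n" "nat_mult n r \<in> V" using V by blast
  have *: "g (x + nat_mult n r) = g x" for x
    using g(3)[rule_format, of "nat_mult n r" 1 x] inv[OF n(2)] by simp
  obtain x0 where x0: "g x0 \<noteq> 0" using g(1) by blast
  from eigenfunction_step[OF n(1) * x0] obtain g' z
    where g': "\<forall>x. g' (x + r) = z * g' x" "\<exists>x. g' x \<noteq> 0"
      "\<forall>u c. (\<forall>x. g (x + u) = c * g x) \<longrightarrow> (\<forall>x. g' (x + u) = c * g' x)"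
    by (elim exE conjE) (rule that; (assumption | (rule exI, assumption)))
  have "\<exists>c. \<forall>x. g' (x + s) = c * g' x" if s: "s \<in> insert r R" for s
  proof (cases "s = r")
    case False
    then obtain c where "\<forall>x. g (x + s) = c * g x" using s g(2) by blast
    then show ?thesis using g'(3) by blast
  qed (use g'(1) in blast)
  moreover have "\<forall>x. g' (x + u) = c * g' x" if "\<forall>x. f (x + u) = c * f x" for u c
    using g'(3) g(3) that by blast
  ultimately show ?case using g'(2) by blast
qed

lemma continuous_on_if_constant_on_cosets:
  fixes \<phi> :: "'k::topological_ab_group_add \<Rightarrow> complex"
  assumes V: "open V" "0 \<in> V" and const: "\<And>x v. v \<in> V \<Longrightarrow> \<phi> (x + v) = \<phi> x"
  shows "continuous_on UNIV \<phi>"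
proof -
  have "open (\<phi> -` B)" for B
  proof (subst open_subopen, intro ballI)
    fix x assume x: "x \<in> \<phi> -` B"
    have "\<phi> y = \<phi> x" if "y - x \<in> V" for y
      using const[OF that, of x] by simp
    then have "{y. y - x \<in> V} \<subseteq> \<phi> -` B" using x by auto
    then show "\<exists>T. open T \<and> x \<in> T \<and> T \<subseteq> \<phi> -` B"
      using open_coset[OF V(1), of x] V(2) by (intro exI[of _ "{y. y - x \<in> V}"]) auto
  qed
  then show ?thesis by (simp add: continuous_on_open_vimage)
qed

text \<open>The indicator of \<open>V\<close> is not invariant under \<open>a\<close>, so it
  projects to an eigenfunction for \<open>a\<close> with eigenvalue different from \<open>1\<close>.
  Diagonalising coset representatives as well gives a joint eigenfunction of all translations, whose
  eigenvalues form the character.\<close>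

lemma exists_character:
  fixes V :: "'k::topological_ab_group_add set"
  assumes comp: "compact (UNIV :: 'k set)" and V: "open V" "add_subgroup V" and a: "a \<notin> V"
  obtains \<psi> :: "'k dual" where "\<And>v. v \<in> V \<Longrightarrow> char_fun \<psi> v = 1" "char_fun \<psi> a \<noteq> 1"
proof -
  have tors: "\<exists>n>0. nat_mult n y \<in> V" for y
    using nat_mult_in_open_subgroup[OF comp V] by metis
  define f where "f x = (if x \<in> V then 1 else 0 :: complex)" for x
  have addV: "x + v \<in> V \<longleftrightarrow> x \<in> V" if "v \<in> V" for x v
    using V(2) that unfolding add_subgroup_def by (metis add_diff_cancel_right' add_subgroup_diff[OF V(2)])
  have f: "f (x + v) = f x" if "v \<in> V" for x v
    using addV[OF that] by (simp add: f_def)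
  have "0 \<in> V" using V(2) by (simp add: add_subgroup_def)
  then have f0: "f 0 \<noteq> 0" "f (0 + a) \<noteq> f 0" using a by (auto simp: f_def)
  obtain n where n: "0 < n" "nat_mult n a \<in> V" using tors by blast
  from eigenfunction_step[OF n(1) f[OF n(2)] f0(1)] obtain g z
    where g: "\<forall>x. g (x + a) = z * g x" "\<exists>x. g x \<noteq> 0"
      "\<forall>u c. (\<forall>x. f (x + u) = c * f x) \<longrightarrow> (\<forall>x. g (x + u) = c * g x)"
      "(\<exists>x. f (x + a) \<noteq> f x) \<longrightarrow> z \<noteq> 1"
    by (elim exE conjE) (rule that; (assumption | (rule exI, assumption)))
  have "z \<noteq> 1" using g(4) f0(2) by blast
  have gV: "g (x + v) = g x" if "v \<in> V" for x v
    using g(3)[rule_format, of v 1 x] f[OF that] by simp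
  obtain R where R: "finite R" "\<And>x. \<exists>r\<in>R. x - r \<in> V"
    using open_subgroup_finite_index[OF comp V] by metis
  have "\<exists>k. (\<exists>x. k x \<noteq> 0) \<and> (\<forall>r\<in>R. \<exists>c. \<forall>x. k (x + r) = c * k x) \<and>
      (\<forall>u c. (\<forall>x. g (x + u) = c * g x) \<longrightarrow> (\<forall>x. k (x + u) = c * k x))"
    by (rule joint_eigenfunction[OF R(1) tors]) (fact gV, fact g(2))
  then obtain k where k: "\<exists>x. k x \<noteq> 0" "\<forall>r\<in>R. \<exists>c. \<forall>x. k (x + r) = c * k x"
    "\<forall>u c. (\<forall>x. g (x + u) = c * g x) \<longrightarrow> (\<forall>x. k (x + u) = c * k x)"
    by (elim exE conjE) (rule that; (assumption | (rule exI, assumption)))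
  obtain x0 where x0: "k x0 \<noteq> 0" using k(1) by blast
  define \<phi> where "\<phi> x = k (x0 + x) / k x0" for x
  have kV: "k (x + v) = k x" if "v \<in> V" for x v
    using k(3)[rule_format, of v 1 x] gV[OF that] by simp
  \<comment> \<open>Every translation is one by a representative \<open>r\<close> followed by one by
    an element of \<open>V\<close>, and the latter leaves \<open>k\<close> unchanged.\<close>
  have eig: "k (t + x) = \<phi> x * k t" for t x
  proof -
    obtain r where r: "r \<in> R" "x - r \<in> V" using R(2) by blast
    then obtain c where c: "\<And>x. k (x + r) = c * k x" using k(2) by blast
    have "k (t + x) = c * k t" for t
      using kV[OF r(2), of "t + r"] c[of t] by simp
    then show ?thesis using x0 by (simp add: \<phi>_def)
  qed
  have mult: "\<phi> (x + y) = \<phi> x * \<phi> y" for x y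
    using eig[of "x0 + x" y] x0 by (simp add: \<phi>_def add.assoc)
  have \<phi>V: "\<phi> v = 1" if "v \<in> V" for v
    using kV[OF that, of x0] x0 by (simp add: \<phi>_def)
  have \<phi>0: "\<phi> 0 = 1" using x0 by (simp add: \<phi>_def)
  have pow: "\<phi> (nat_mult m x) = \<phi> x ^ m" for m x
    by (induction m) (simp_all add: mult \<phi>0)
  \<comment> \<open>Some positive multiple of \<open>x\<close> lies in \<open>V\<close>, so
    \<open>\<phi> x\<close> is a root of unity.\<close>
  have norm: "norm (\<phi> x) = 1" for x
  proof -
    obtain m where m: "0 < m" "nat_mult m x \<in> V" using tors by blast
    then have "\<phi> x ^ m = 1" using pow \<phi>V by metis
    then show ?thesis using m(1) power_eq_1_iff by blast
  qed
  have cont: "continuous_on UNIV \<phi>"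
    by (rule continuous_on_if_constant_on_cosets[OF V(1) \<open>0 \<in> V\<close>]) (simp add: mult \<phi>V)
  have rep: "char_fun (Abs_dual \<phi>) = \<phi>"
    using cont norm mult by (intro Abs_dual_inverse) auto
  have "k (x0 + a) = z * k x0" using k(3) g(1) by blast
  then have "\<phi> a = z" using x0 by (simp add: \<phi>_def)
  then show ?thesis using that[of "Abs_dual \<phi>"] rep \<phi>V \<open>z \<noteq> 1\<close> by simp
qed


section \<open>Finite groups of characters and partitions\<close>

lemma char_fun_nonzero: "char_fun \<psi> x \<noteq> 0"
  using char_fun[of \<psi>] by (metis (mono_tags, lifting) mem_Collect_eq norm_zero zero_neq_one)

lemma char_fun_add: "char_fun \<psi> (x + y) = char_fun \<psi> x * char_fun \<psi> y"
  using char_fun[of \<psi>] by simp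

lemma continuous_char_fun: "continuous_on UNIV (char_fun \<psi>)"
  using char_fun[of \<psi>] by simp

lemma char_fun_zero_right: "char_fun \<psi> 0 = 1"
  using char_fun_add[of \<psi> 0 0] char_fun_nonzero[of \<psi> 0] by simp

lemma char_fun_diff: "char_fun \<psi> (x - y) = char_fun \<psi> x / char_fun \<psi> y"
  using char_fun_add[of \<psi> "x - y" y] char_fun_nonzero[of \<psi> y] by (simp add: field_simps)

lemma char_fun_nat_mult: "char_fun \<psi> (nat_mult n x) = char_fun \<psi> x ^ n"
  by (induction n) (simp_all add: char_fun_add char_fun_zero_right)

lemma dual_eqI: "(\<And>x. char_fun \<phi> x = char_fun \<psi> x) \<Longrightarrow> \<phi> = \<psi>"
  by (rule char_fun_inject[THEN iffD1]) (rule ext)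

text \<open>The coset of \<open>x\<close> modulo the common kernel of the characters in
  \<open>X\<close>.\<close>

definition char_class :: "'k::topological_ab_group_add dual set \<Rightarrow> 'k \<Rightarrow> 'k set"
  where "char_class X x = {y. \<forall>\<psi>\<in>X. char_fun \<psi> y = char_fun \<psi> x}"

lemma char_class_self: "x \<in> char_class X x"
  by (simp add: char_class_def)

lemma char_class_eq: "y \<in> char_class X x \<Longrightarrow> char_class X y = char_class X x"
  by (auto simp: char_class_def)

lemma closed_char_class: "closed (char_class X x)"
proof -
  have "char_class X x = (\<Inter>\<psi>\<in>X. char_fun \<psi> -` {char_fun \<psi> x})"
    by (auto simp: char_class_def)
  then show ?thesis
    by (auto intro!: closed_INT closed_vimage continuous_char_fun)
qed

lemma open_char_class:
  assumes "finite (range (char_class X))"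
  shows "open (char_class X x)"
proof -
  have eq: "char_class X x = - \<Union>(range (char_class X) - {char_class X x})"
  proof (intro set_eqI iffI)
    fix y assume y: "y \<in> char_class X x"
    have "char_class X z = char_class X x" if "y \<in> char_class X z" for z
      using char_class_eq[OF that] char_class_eq[OF y] by simp
    then show "y \<in> - \<Union>(range (char_class X) - {char_class X x})" by blast
  next
    fix y assume "y \<in> - \<Union>(range (char_class X) - {char_class X x})"
    then have "char_class X y = char_class X x" using char_class_self[of y X] by blast
    then show "y \<in> char_class X x" using char_class_self[of y X] by simp
  qed
  have "closed (\<Union>(range (char_class X) - {char_class X x}))"
    using assms by (intro closed_Union) (auto intro: closed_char_class)
  then show ?thesis by (subst eq) (rule open_Compl)
qed

text \<open>Members of a finite group have finite order, so their values are roots of unity and only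
  finitely many value patterns on \<open>X\<close> occur.\<close>

lemma finite_char_classes:
  assumes X: "finite X" "add_subgroup X"
  shows "finite (range (char_class X))"
proof -
  have "\<exists>n>0. \<forall>x. char_fun \<psi> x ^ n = 1" if \<psi>: "\<psi> \<in> X" for \<psi>
  proof -
    have rep: "char_fun (nat_mult n \<psi>) x = char_fun \<psi> x ^ n" for n x
      by (induction n) (simp_all add: zero_dual.rep_eq plus_dual.rep_eq)
    have "nat_mult n \<psi> \<in> X" for n
      using X(2) \<psi> by (induction n) (auto simp: add_subgroup_def)
    then have "finite (range (\<lambda>n. nat_mult n \<psi>))"
      by (intro finite_subset[OF _ X(1)]) auto
    then have "\<not> inj (\<lambda>n. nat_mult n \<psi>)"
      using finite_imageD[of "\<lambda>n. nat_mult n \<psi>" UNIV] by auto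
    then obtain m n where mn: "m < n" "nat_mult m \<psi> = nat_mult n \<psi>"
      unfolding inj_def by (metis linorder_neqE_nat)
    have "char_fun \<psi> x ^ (n - m) = 1" for x
    proof -
      have "char_fun \<psi> x ^ m * char_fun \<psi> x ^ (n - m) = char_fun \<psi> x ^ m"
        using rep[of m x] rep[of n x] mn by (simp flip: power_add)
      then show ?thesis using char_fun_nonzero[of \<psi> x] by simp
    qed
    then show ?thesis using mn(1) by (intro exI[of _ "n - m"]) auto
  qed
  then obtain n where n: "\<And>\<psi>. \<psi> \<in> X \<Longrightarrow> n \<psi> > 0 \<and> (\<forall>x. char_fun \<psi> x ^ n \<psi> = 1)" by metis
  let ?ev = "\<lambda>x. \<lambda>\<psi>\<in>X. char_fun \<psi> x"
  have "range ?ev \<subseteq> (\<Pi>\<^sub>E \<psi>\<in>X. {z. z ^ n \<psi> = 1})"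
    using n by (auto simp: PiE_def)
  moreover have "finite (\<Pi>\<^sub>E \<psi>\<in>X. {z::complex. z ^ n \<psi> = 1})"
    using X(1) n by (intro finite_PiE finite_roots_unity) (auto simp: Suc_le_eq)
  ultimately have fin: "finite (range ?ev)" by (rule finite_subset)
  have "char_class X x = {y. ?ev y = ?ev x}" for x
    by (auto simp: char_class_def restrict_def fun_eq_iff)
  then have "range (char_class X) = (\<lambda>v. {y. ?ev y = v}) ` range ?ev"
    by auto
  then show ?thesis using fin by simp
qed

text \<open>Both cardinalities are the value of the double sum of \<open>\<psi>(x)\<close> over all \<open>\<psi> \<in> X\<close> and all classes.\<close>

lemma card_char_classes:
  fixes X :: "'k::topological_ab_group_add dual set"
  assumes X: "finite X" "add_subgroup X"
  shows "card (range (char_class X)) = card X"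
proof -
  let ?Q = "range (char_class X)"
  note finQ = finite_char_classes[OF X]
  define r where "r C = (SOME x. x \<in> C)" for C :: "'k set"
  have r: "char_class X (r C) = C" if C: "C \<in> ?Q" for C
  proof -
    obtain x where x: "C = char_class X x" using C by (rule rangeE)
    then have "r C \<in> C" unfolding r_def some_in_eq using char_class_self by blast
    then show ?thesis using x char_class_eq by auto
  qed
  \<comment> \<open>Translation by a point \<open>y\<close> where \<open>\<psi>\<close> is
    nontrivial permutes the classes and multiplies the sum by
    \<open>char_fun \<psi> y\<close>.\<close>
  have "(\<Sum>C\<in>?Q. char_fun \<psi> (r C)) = 0" if \<psi>: "\<psi> \<in> X" "\<psi> \<noteq> 0" for \<psi>
  proof -
    obtain y where y: "char_fun \<psi> y \<noteq> 1"
      using \<psi>(2) dual_eqI[of \<psi> 0] by (auto simp: zero_dual.rep_eq)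
    let ?p = "\<lambda>C. char_class X (y + r C)"
    have inj: "inj_on ?p ?Q"
    proof (rule inj_onI)
      fix C D assume CD: "C \<in> ?Q" "D \<in> ?Q" "?p C = ?p D"
      then have "y + r C \<in> char_class X (y + r D)"
        using char_class_self[of "y + r C" X] by simp
      then have "r C \<in> char_class X (r D)"
        by (auto simp: char_class_def char_fun_add char_fun_nonzero)
      then have "char_class X (r C) = char_class X (r D)" by (rule char_class_eq)
      then show "C = D" using r CD by simp
    qed
    have "?p ` ?Q = ?Q" by (rule endo_inj_surj[OF finQ _ inj]) auto
    then have bij: "bij_betw ?p ?Q ?Q" using inj by (simp add: bij_betw_def)
    show ?thesis
    proof (rule sum_zero_if_eigen_shift[OF bij _ y])
      fix C assume "C \<in> ?Q"
      have "y + r C \<in> char_class X (r (?p C))"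
        using r[of "?p C"] char_class_self[of "y + r C" X] by simp
      then have "char_fun \<psi> (r (?p C)) = char_fun \<psi> (y + r C)"
        using \<psi>(1) by (simp add: char_class_def)
      then show "char_fun \<psi> (r (?p C)) = char_fun \<psi> y * char_fun \<psi> (r C)"
        by (simp add: char_fun_add)
    qed
  qed
  then have "(\<Sum>\<psi>\<in>X. \<Sum>C\<in>?Q. char_fun \<psi> (r C)) = (\<Sum>\<psi>\<in>{0}. \<Sum>C\<in>?Q. char_fun \<psi> (r C))"
    using X by (intro sum.mono_neutral_right) (auto simp: add_subgroup_def)
  also have "\<dots> = of_nat (card ?Q)"
    by (simp add: zero_dual.rep_eq)
  finally have 1: "(\<Sum>\<psi>\<in>X. \<Sum>C\<in>?Q. char_fun \<psi> (r C)) = of_nat (card ?Q)" .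
  \<comment> \<open>Dually, some \<open>\<phi> \<in> X\<close> is nontrivial on a class other than
    that of \<open>0\<close>, and adding \<open>\<phi>\<close> permutes \<open>X\<close>.\<close>
  have "(\<Sum>\<psi>\<in>X. char_fun \<psi> (r C)) = 0" if C: "C \<in> ?Q" "C \<noteq> char_class X 0" for C
  proof -
    have "r C \<notin> char_class X 0"
      using char_class_eq[of "r C" X 0] r[OF C(1)] C(2) by auto
    then obtain \<phi> where \<phi>: "\<phi> \<in> X" "char_fun \<phi> (r C) \<noteq> 1"
      by (auto simp: char_class_def char_fun_zero_right)
    have bij: "bij_betw ((+) \<phi>) X X"
    proof (rule bij_betwI[of _ _ _ "\<lambda>\<psi>. - \<phi> + \<psi>"])
      show "(+) \<phi> \<in> X \<rightarrow> X"
        using X(2) \<phi>(1) by (auto simp: add_subgroup_def)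
      have "- \<phi> \<in> X" using X(2) \<phi>(1) by (auto simp: add_subgroup_def)
      then show "(\<lambda>\<psi>. - \<phi> + \<psi>) \<in> X \<rightarrow> X"
        using X(2) by (auto simp: add_subgroup_def)
    qed auto
    show ?thesis
      by (rule sum_zero_if_eigen_shift[OF bij _ \<phi>(2)]) (simp add: plus_dual.rep_eq)
  qed
  then have "(\<Sum>C\<in>?Q. \<Sum>\<psi>\<in>X. char_fun \<psi> (r C)) = (\<Sum>C\<in>{char_class X 0}. \<Sum>\<psi>\<in>X. char_fun \<psi> (r C))"
    using finQ by (intro sum.mono_neutral_right) auto
  also have "\<dots> = (\<Sum>\<psi>\<in>X. 1)"
  proof -
    have "r (char_class X 0) \<in> char_class X 0"
      using r[of "char_class X 0"] char_class_self[of "r (char_class X 0)" X] by simp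
    then show ?thesis by (simp add: char_class_def char_fun_zero_right)
  qed
  finally have 2: "(\<Sum>C\<in>?Q. \<Sum>\<psi>\<in>X. char_fun \<psi> (r C)) = of_nat (card X)" by simp
  have "(of_nat (card ?Q) :: complex) = of_nat (card X)"
    using 1 2 sum.swap[of "\<lambda>\<psi> C. char_fun \<psi> (r C)" ?Q X] by simp
  then show ?thesis by (simp only: of_nat_eq_iff)
qed

lemma open_cover_char_classes:
  assumes "finite X" "add_subgroup X"
  shows "open_cover (range (char_class X))"
proof -
  have "\<Union>(range (char_class X)) = UNIV" using char_class_self by blast
  then show ?thesis
    using open_char_class[OF finite_char_classes[OF assms]] by (auto simp: open_cover_def)
qed

section \<open>Joins of class partitions as classes of trajectories\<close>

lemma add_subgroup_image:
  assumes f: "Modules.additive f" and X: "add_subgroup X"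
  shows "add_subgroup (f ` X)"
proof -
  interpret Modules.additive f by fact
  show ?thesis
    using X unfolding add_subgroup_def
    by (auto simp: zero minus[symmetric] add[symmetric] image_iff) (metis zero)
qed

lemma add_subgroup_set_plus:
  assumes A: "add_subgroup A" and B: "add_subgroup B"
  shows "add_subgroup (A + B)"
  unfolding add_subgroup_def
proof (intro conjI ballI)
  show "0 \<in> A + B"
    using set_plus_intro[of 0 A 0 B] A B by (simp add: add_subgroup_def)
next
  fix x y assume "x \<in> A + B" "y \<in> A + B"
  then obtain a b c d where "a \<in> A" "b \<in> B" "c \<in> A" "d \<in> B" "x = a + b" "y = c + d"
    by (auto elim!: set_plus_elim)
  moreover from this have "(a + c) + (b + d) \<in> A + B"
    using A B by (intro set_plus_intro) (auto simp: add_subgroup_def)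
  ultimately show "x + y \<in> A + B" by (simp add: add_ac)
next
  fix x assume "x \<in> A + B"
  then obtain a b where "a \<in> A" "b \<in> B" "x = a + b"
    by (auto elim!: set_plus_elim)
  moreover from this have "- a + - b \<in> A + B"
    using A B by (intro set_plus_intro) (auto simp: add_subgroup_def)
  ultimately show "- x \<in> A + B" by simp
qed

lemma add_subgroup_trajectory:
  assumes "\<And>s. Modules.additive (\<beta> s)" "add_subgroup X" "finite F"
  shows "add_subgroup (trajectory \<beta> F X)"
  using assms(3)
proof (induction F rule: finite_induct)
  case empty
  then show ?case by (simp add: trajectory_empty add_subgroup_def)
next
  case (insert s F)
  then show ?case
    by (simp add: trajectory_insert add_subgroup_set_plus add_subgroup_image assms)
qed

lemma char_class_set_plus:
  assumes "0 \<in> A" "0 \<in> B"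
  shows "char_class (A + B) x = char_class A x \<inter> char_class B x"
proof
  have "A \<subseteq> A + B" "B \<subseteq> A + B"
    using set_plus_intro[of _ A 0 B] set_plus_intro[of 0 A _ B] assms by auto
  then show "char_class (A + B) x \<subseteq> char_class A x \<inter> char_class B x"
    by (auto simp: char_class_def)
  show "char_class A x \<inter> char_class B x \<subseteq> char_class (A + B) x"
    by (auto simp: char_class_def plus_dual.rep_eq elim!: set_plus_elim)
qed

text \<open>Since \<open>0 \<in> X\<close>, every summand \<open>\<psi> \<circ> \<gamma> s\<close>
  belongs to the trajectory by itself. Points are thus equivalent for the trajectory exactly when,
  for each \<open>s \<in> F\<close>, their images under \<open>\<gamma> s\<close> are equivalent for
  \<open>X\<close>.\<close>

lemma char_class_trajectory:
  fixes \<gamma> :: "'s \<Rightarrow> 'k::topological_ab_group_add \<Rightarrow> 'k"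
  assumes endo: "\<And>s. continuous_endo (\<gamma> s)" and X: "add_subgroup X" and F: "finite F"
  shows "char_class (trajectory (dual_action \<gamma>) F X) x = (\<Inter>s\<in>F. \<gamma> s -` char_class X (\<gamma> s x))"
  using F
proof (induction F rule: finite_induct)
  case empty
  then show ?case by (simp add: trajectory_empty char_class_def zero_dual.rep_eq)
next
  case (insert s F)
  have add: "Modules.additive (dual_action \<gamma> s)" for s
    by (rule additive_dual_action[OF endo])
  have "char_class (dual_action \<gamma> s ` X) x = \<gamma> s -` char_class X (\<gamma> s x)"
    by (auto simp: char_class_def dual_action_def char_fun_dual_map[OF endo])
  moreover have "0 \<in> dual_action \<gamma> s ` X" "0 \<in> trajectory (dual_action \<gamma>) F X"
    using add_subgroup_image[OF add X] add_subgroup_trajectory[OF add X insert(1)]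
    by (auto simp: add_subgroup_def)
  ultimately show ?case
    using insert by (simp add: trajectory_insert char_class_set_plus)
qed

text \<open>The duality at a fixed finite \<open>F\<close>. The trajectory is again a finite group
  of characters, and its classes are the nonempty members of the join, so
  \<open>card_char_classes\<close> applies to the trajectory itself.\<close>

lemma min_subcover_card_join_char_classes:
  fixes \<gamma> :: "'s \<Rightarrow> 'k::topological_ab_group_add \<Rightarrow> 'k"
  assumes endo: "\<And>s. continuous_endo (\<gamma> s)" and X: "finite X" "add_subgroup X" and F: "finite F"
  shows "min_subcover_card (join_cover \<gamma> F (range (char_class X))) = card (trajectory (dual_action \<gamma>) F X)"
proof -
  let ?T = "trajectory (dual_action \<gamma>) F X"
  let ?J = "join_cover \<gamma> F (range (char_class X))"
  have T: "finite ?T" "add_subgroup ?T"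
    using finite_trajectory[OF F X(1)] add_subgroup_trajectory[OF additive_dual_action[of \<gamma>, OF endo] X(2) F] by auto
  have cls: "char_class ?T x = (\<Inter>s\<in>F. \<gamma> s -` char_class X (\<gamma> s x))" for x
    by (rule char_class_trajectory[OF endo X(2) F])
  have sub: "W = char_class ?T x" if W: "W \<in> ?J" "x \<in> W" for W x
  proof -
    obtain V where V: "W = (\<Inter>s\<in>F. \<gamma> s -` V s)" "\<forall>s\<in>F. V s \<in> range (char_class X)"
      using W(1) unfolding join_cover_def by blast
    have "V s = char_class X (\<gamma> s x)" if "s \<in> F" for s
      using V W(2) that char_class_eq[of "\<gamma> s x" X] by fastforce
    then show ?thesis unfolding V(1) cls by simp
  qed
  have mem: "char_class ?T x \<in> ?J" for x
    unfolding cls join_cover_def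
    by (intro CollectI exI[of _ "\<lambda>s. char_class X (\<gamma> s x)"]) auto
  have eq: "?J - {{}} = range (char_class ?T)"
  proof
    show "?J - {{}} \<subseteq> range (char_class ?T)" using sub by blast
    show "range (char_class ?T) \<subseteq> ?J - {{}}"
    proof (rule image_subsetI)
      fix x show "char_class ?T x \<in> ?J - {{}}" using mem[of x] char_class_self[of x ?T] by blast
    qed
  qed
  have "min_subcover_card ?J = card (?J - {{}})"
  proof (rule min_subcover_card_partition)
    show "\<Union>?J = UNIV" using mem char_class_self by blast
    \<comment> \<open>Inherited from the nonempty members; the empty set adds at most one.\<close>
    show "finite ?J"
      using finite_char_classes[OF T] finite_Diff2[of "{{}}" ?J] eq by simp
    show "U \<inter> V = {}" if "U \<in> ?J" "V \<in> ?J" "U \<noteq> V" for U V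
    proof (rule ccontr)
      assume "U \<inter> V \<noteq> {}"
      then obtain x where "x \<in> U" "x \<in> V" by blast
      then show False using sub[of U x] sub[of V x] that by simp
    qed
  qed
  then show ?thesis using eq card_char_classes[OF T] by simp
qed

section \<open>Annihilators of open subgroups\<close>

definition annihilator :: "'k::topological_ab_group_add set \<Rightarrow> 'k dual set"
  where "annihilator V = {\<psi>. \<forall>v\<in>V. char_fun \<psi> v = 1}"

lemma add_subgroup_annihilator: "add_subgroup (annihilator V)"
  by (auto simp: add_subgroup_def annihilator_def zero_dual.rep_eq plus_dual.rep_eq uminus_dual.rep_eq)

text \<open>A character trivial on \<open>V\<close> is determined by its values at finitely many
  coset representatives, and these values are roots of unity of bounded order.\<close>

lemma finite_annihilator:
  fixes V :: "'k::topological_ab_group_add set"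
  assumes comp: "compact (UNIV :: 'k set)" and V: "open V" "add_subgroup V"
  shows "finite (annihilator V)"
proof -
  obtain R where R: "finite R" "\<And>x. \<exists>r\<in>R. x - r \<in> V"
    using open_subgroup_finite_index[OF comp V] by metis
  have "\<forall>x. \<exists>n>0. nat_mult n x \<in> V"
    using nat_mult_in_open_subgroup[OF comp V] by metis
  then obtain n where n: "\<And>x. 0 < n x \<and> nat_mult (n x) x \<in> V" by metis
  let ?ev = "\<lambda>\<psi>. \<lambda>r\<in>R. char_fun \<psi> r"
  have "inj_on ?ev (annihilator V)"
  proof (rule inj_onI)
    fix \<phi> \<psi> assume *: "\<phi> \<in> annihilator V" "\<psi> \<in> annihilator V" "?ev \<phi> = ?ev \<psi>"
    show "\<phi> = \<psi>"
    proof (rule dual_eqI)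
      fix x
      obtain r where r: "r \<in> R" "x - r \<in> V" using R(2) by blast
      have "char_fun \<phi> r = char_fun \<psi> r"
        using fun_cong[OF *(3), of r] r(1) by simp
      moreover have "char_fun \<phi> (x - r) = 1" "char_fun \<psi> (x - r) = 1"
        using * r(2) by (auto simp: annihilator_def)
      ultimately show "char_fun \<phi> x = char_fun \<psi> x"
        using char_fun_add[of \<phi> "x - r" r] char_fun_add[of \<psi> "x - r" r] by simp
    qed
  qed
  moreover have "?ev ` annihilator V \<subseteq> (\<Pi>\<^sub>E r\<in>R. {z. z ^ n r = 1})"
  proof -
    have "char_fun \<psi> r ^ n r = 1" if "\<psi> \<in> annihilator V" for \<psi> r
      using that n[of r] char_fun_nat_mult[of \<psi> "n r" r] by (simp add: annihilator_def)
    then show ?thesis by auto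
  qed
  moreover have "finite (\<Pi>\<^sub>E r\<in>R. {z::complex. z ^ n r = 1})"
    using R(1) n by (intro finite_PiE finite_roots_unity) (auto simp: Suc_le_eq)
  ultimately show ?thesis
    using inj_on_finite by blast
qed

text \<open>Characters trivial on \<open>V\<close> separate the cosets of \<open>V\<close>, by
  \<open>exists_character\<close>.\<close>

lemma char_class_annihilator_subset:
  fixes V :: "'k::topological_ab_group_add set"
  assumes comp: "compact (UNIV :: 'k set)" and V: "open V" "add_subgroup V"
  shows "char_class (annihilator V) x \<subseteq> {y. y - x \<in> V}"
proof
  fix y assume y: "y \<in> char_class (annihilator V) x"
  show "y \<in> {y. y - x \<in> V}"
  proof (rule ccontr)
    assume "y \<notin> {y. y - x \<in> V}"
    then obtain \<psi> :: "'k dual" where \<psi>: "\<And>v. v \<in> V \<Longrightarrow> char_fun \<psi> v = 1" "char_fun \<psi> (y - x) \<noteq> 1"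
      using exists_character[OF comp V, of "y - x"] by auto
    then have "char_fun \<psi> y = char_fun \<psi> x"
      using y by (simp add: char_class_def annihilator_def)
    then show False
      using \<psi>(2) by (simp add: char_fun_diff char_fun_nonzero)
  qed
qed

text \<open>Near \<open>1\<close> doubling expands: \<open>z^2 - 1 = (z + 1) * (z - 1)\<close> with
  \<open>norm (z + 1) \<ge> 3 / 2\<close>. Repeated doubling of an element with nontrivial value
  would therefore leave the ball of radius \<open>1 / 2\<close>.\<close>

lemma no_small_subgroups:
  assumes V: "add_subgroup V" and small: "\<And>v. v \<in> V \<Longrightarrow> norm (char_fun \<psi> v - 1) < 1 / 2"
    and v: "v \<in> V"
  shows "char_fun \<psi> v = 1"
proof (rule ccontr)
  assume ne: "char_fun \<psi> v \<noteq> 1"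
  have step: "3 / 2 * norm (char_fun \<psi> u - 1) \<le> norm (char_fun \<psi> (u + u) - 1)" if "u \<in> V" for u
  proof -
    let ?z = "char_fun \<psi> u"
    have "2 = norm ((?z + 1) - (?z - 1))" by simp
    also have "\<dots> \<le> norm (?z + 1) + norm (?z - 1)" by (rule norm_triangle_ineq4)
    finally have "3 / 2 \<le> norm (?z + 1)" using small[OF that] by simp
    then have "3 / 2 * norm (?z - 1) \<le> norm (?z + 1) * norm (?z - 1)"
      by (rule mult_right_mono) simp
    also have "\<dots> = norm (char_fun \<psi> (u + u) - 1)"
      by (simp add: char_fun_add algebra_simps flip: norm_mult)
    finally show ?thesis .
  qed
  have grow: "\<exists>u\<in>V. (3 / 2) ^ n * norm (char_fun \<psi> v - 1) \<le> norm (char_fun \<psi> u - 1)" for n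
  proof (induction n)
    case 0
    then show ?case using v by auto
  next
    case (Suc n)
    then obtain u where u: "u \<in> V" "(3 / 2) ^ n * norm (char_fun \<psi> v - 1) \<le> norm (char_fun \<psi> u - 1)"
      by blast
    have "(3 / 2) ^ Suc n * norm (char_fun \<psi> v - 1) \<le> norm (char_fun \<psi> (u + u) - 1)"
      using u(2) step[OF u(1)] by simp
    moreover have "u + u \<in> V" using u(1) V by (simp add: add_subgroup_def)
    ultimately show ?case by blast
  qed
  obtain n where "1 / norm (char_fun \<psi> v - 1) < (3 / 2) ^ n"
    using real_arch_pow[of "3 / 2 :: real"] by auto
  then have "1 < (3 / 2) ^ n * norm (char_fun \<psi> v - 1)"
    using ne by (simp add: pos_divide_less_eq)
  moreover obtain u where "u \<in> V" "(3 / 2) ^ n * norm (char_fun \<psi> v - 1) \<le> norm (char_fun \<psi> u - 1)"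
    using grow by blast
  ultimately show False using small[of u] by simp
qed

text \<open>On a small open subgroup the finitely many characters are all close to \<open>1\<close>,
  hence equal to \<open>1\<close>. This reduces arbitrary finite sets of characters to finite
  groups.\<close>

lemma exists_annihilator_superset:
  fixes X :: "'k::{topological_ab_group_add, t2_space} dual set"
  assumes comp: "compact (UNIV :: 'k set)" and td: "totally_disconnected (UNIV :: 'k set)"
    and X: "finite X"
  obtains V where "open V" "add_subgroup V" "X \<subseteq> annihilator V"
proof -
  let ?W = "\<Inter>\<psi>\<in>X. {x. norm (char_fun \<psi> x - 1) < 1 / 2}"
  have "open {x. norm (char_fun \<psi> x - 1) < 1 / 2}" for \<psi> :: "'k dual"
    by (intro open_Collect_less continuous_intros continuous_char_fun)
  then have "open ?W" using X by auto
  moreover have "0 \<in> ?W" by (simp add: char_fun_zero_right)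
  ultimately obtain V where V: "open V" "add_subgroup V" "V \<subseteq> ?W"
    using open_subgroup_base[OF comp td] by blast
  have "char_fun \<psi> v = 1" if \<psi>: "\<psi> \<in> X" and v: "v \<in> V" for \<psi> v
  proof (rule no_small_subgroups[OF V(2) _ v])
    fix u assume "u \<in> V"
    then show "norm (char_fun \<psi> u - 1) < 1 / 2" using V(3) \<psi> by blast
  qed
  then have "X \<subseteq> annihilator V" by (auto simp: annihilator_def)
  then show ?thesis using that V by blast
qed

text \<open>The analogue of the Lebesgue number lemma, with a subgroup in place of a radius.\<close>

lemma exists_Lebesgue_subgroup:
  fixes \<U> :: "'k::{topological_ab_group_add, t2_space} set set"
  assumes comp: "compact (UNIV :: 'k set)" and td: "totally_disconnected (UNIV :: 'k set)"
    and \<U>: "open_cover \<U>"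
  obtains V where "open V" "add_subgroup V" "\<And>x. \<exists>U\<in>\<U>. {y. y - x \<in> V} \<subseteq> U"
proof -
  have "\<exists>V. open V \<and> add_subgroup V \<and> (\<exists>U\<in>\<U>. {y. y - x \<in> V} \<subseteq> U)" for x
  proof -
    have "x \<in> \<Union>\<U>" using \<U> by (simp add: open_cover_def)
    then obtain U where U: "U \<in> \<U>" "x \<in> U" "open U"
      using \<U> unfolding open_cover_def by blast
    have "open ((\<lambda>v. v + x) -` U)"
      using U by (intro open_vimage continuous_intros)
    moreover have "0 \<in> (\<lambda>v. v + x) -` U" using U by simp
    ultimately obtain V where V: "open V" "add_subgroup V" "V \<subseteq> (\<lambda>v. v + x) -` U"
      using open_subgroup_base[OF comp td] by blast
    have "{y. y - x \<in> V} \<subseteq> U" using V(3) by auto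
    then show ?thesis using V U by blast
  qed
  then obtain V where V: "\<And>x. open (V x)" "\<And>x. add_subgroup (V x)"
    "\<And>x. \<exists>U\<in>\<U>. {y. y - x \<in> V x} \<subseteq> U" by metis
  have op: "open {y. y - x \<in> V x}" for x
    by (rule open_coset[OF V(1)])
  have cov: "UNIV \<subseteq> (\<Union>x\<in>UNIV. {y. y - x \<in> V x})"
    using V(2) by (auto simp: add_subgroup_def)
  obtain R where "R \<subseteq> UNIV" and R: "finite R" "UNIV \<subseteq> (\<Union>x\<in>R. {y. y - x \<in> V x})"
    using compactE_image[OF comp op cov] .
  have "open (\<Inter>x\<in>R. V x)" using R V(1) by auto
  moreover have "add_subgroup (\<Inter>x\<in>R. V x)" using V(2) by (auto simp: add_subgroup_def)
  moreover have "\<exists>U\<in>\<U>. {y. y - z \<in> (\<Inter>x\<in>R. V x)} \<subseteq> U" for z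
  proof -
    obtain x where x: "x \<in> R" "z - x \<in> V x" using R(2) by blast
    \<comment> \<open>Closure of \<open>V x\<close> under addition replaces the halving of radii in
      the metric argument.\<close>
    have "y - x \<in> V x" if "y - z \<in> (\<Inter>x\<in>R. V x)" for y
    proof -
      have "y - z \<in> V x" using that x(1) by blast
      then have "(y - z) + (z - x) \<in> V x"
        using x(2) V(2)[of x] unfolding add_subgroup_def by blast
      then show ?thesis by simp
    qed
    then show ?thesis using V(3)[of x] by blast
  qed
  ultimately show ?thesis by (rule that)
qed


section \<open>Comparison of the entropies\<close>

text \<open>The termwise inequality passes to the values of \<open>Lim\<close> because both nets
  converge.\<close>

lemma H_top_mono:
  fixes \<gamma> :: "'s::monoid_mult \<Rightarrow> 'c \<Rightarrow> 'c::topological_space" and F :: "'i::preorder \<Rightarrow> 's set"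
  assumes canc: "cancellative TYPE('s)"
    and comp: "compact (UNIV :: 'c set)" and cont: "\<And>s. continuous_on UNIV (\<gamma> s)"
    and act: "left_action \<gamma>" and F: "left_Folner_net F"
    and \<U>: "open_cover \<U>" and \<W>: "open_cover \<W>" and ref: "\<And>W. W \<in> \<W> \<Longrightarrow> \<exists>U\<in>\<U>. W \<subseteq> U"
  shows "H_top F \<gamma> \<U> \<le> H_top F \<gamma> \<W>"
proof -
  let ?h = "\<lambda>\<U> F. ln (real (min_subcover_card (join_cover \<gamma> F \<U>)))"
  interpret U: subadditive_set_function "?h \<U>"
    by (rule subadditive_join_cover[OF canc comp cont act \<U>])
  interpret W: subadditive_set_function "?h \<W>"
    by (rule subadditive_join_cover[OF canc comp cont act \<W>])
  have "(tails :: 'i filter) \<noteq> bot"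
    using F by (intro tails_neq_bot) (simp add: left_Folner_net_def)
  moreover have "?h \<U> (F i) / real (card (F i)) \<le> ?h \<W> (F i) / real (card (F i))" for i
  proof -
    have fin: "finite (F i)" using F by (simp add: left_Folner_net_def)
    have "min_subcover_card (join_cover \<gamma> (F i) \<U>) \<le> min_subcover_card (join_cover \<gamma> (F i) \<W>)"
      by (rule min_subcover_card_mono[OF comp open_cover_join[OF cont \<W> fin] join_cover_refines[OF ref]])
    moreover have "0 < min_subcover_card (join_cover \<gamma> (F i) \<U>)"
      by (rule min_subcover_card_pos[OF comp open_cover_join[OF cont \<U> fin]])
    ultimately show ?thesis
      by (intro divide_right_mono ln_mono) auto
  qed
  ultimately have "U.asymptotic_density \<le> W.asymptotic_density"
    by (intro tendsto_le[OF _ W.Ornstein_Weiss[OF F] U.Ornstein_Weiss[OF F]] always_eventually) auto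
  then show ?thesis
    unfolding H_top_def U.Lim_Folner[OF F] W.Lim_Folner[OF F] .
qed

lemma H_alg_mono:
  fixes \<beta> :: "'s::monoid_mult \<Rightarrow> 'a \<Rightarrow> 'a::ab_group_add" and F :: "'i::preorder \<Rightarrow> 's set"
  assumes canc: "cancellative TYPE('s)"
    and act: "right_action \<beta>" and add: "\<And>s. Modules.additive (\<beta> s)"
    and F: "left_Folner_net F" and X: "X \<noteq> {}" "X \<subseteq> Y" and Y: "finite Y"
  shows "H_alg F \<beta> X \<le> H_alg F \<beta> Y"
proof -
  let ?h = "\<lambda>X F. ln (real (card (trajectory \<beta> F X)))"
  have X': "finite X" "Y \<noteq> {}" using X Y finite_subset by auto
  interpret X: subadditive_set_function "?h X"
    by (rule subadditive_trajectory[OF canc act add X'(1) X(1)])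
  interpret Y: subadditive_set_function "?h Y"
    by (rule subadditive_trajectory[OF canc act add Y X'(2)])
  have "(tails :: 'i filter) \<noteq> bot"
    using F by (intro tails_neq_bot) (simp add: left_Folner_net_def)
  moreover have "?h X (F i) / real (card (F i)) \<le> ?h Y (F i) / real (card (F i))" for i
  proof -
    have fin: "finite (F i)" using F by (simp add: left_Folner_net_def)
    have "card (trajectory \<beta> (F i) X) \<le> card (trajectory \<beta> (F i) Y)"
      by (rule card_mono[OF finite_trajectory[OF fin Y] trajectory_mono[OF fin X(2)]])
    moreover have "0 < card (trajectory \<beta> (F i) X)"
      using trajectory_nonempty[OF fin X(1)] finite_trajectory[OF fin X'(1)] by (simp add: card_gt_0_iff)
    ultimately show ?thesis
      by (intro divide_right_mono ln_mono) auto
  qed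
  ultimately have "X.asymptotic_density \<le> Y.asymptotic_density"
    by (intro tendsto_le[OF _ Y.Ornstein_Weiss[OF F] X.Ornstein_Weiss[OF F]] always_eventually) auto
  then show ?thesis
    unfolding H_alg_def X.Lim_Folner[OF F] Y.Lim_Folner[OF F] .
qed

lemma H_alg_independent_of_net:
  fixes \<beta> :: "'s::monoid_mult \<Rightarrow> 'a \<Rightarrow> 'a::ab_group_add"
    and F :: "'i::preorder \<Rightarrow> 's set" and G :: "'j::preorder \<Rightarrow> 's set"
  assumes "cancellative TYPE('s)" "right_action \<beta>" "\<And>s. Modules.additive (\<beta> s)"
    and "finite X" "X \<noteq> {}" and F: "left_Folner_net F" and G: "left_Folner_net G"
  shows "H_alg F \<beta> X = H_alg G \<beta> X"
proof -
  interpret subadditive_set_function "\<lambda>F. ln (real (card (trajectory \<beta> F X)))"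
    using assms(1-5) by (rule subadditive_trajectory)
  show ?thesis
    unfolding H_alg_def Lim_Folner[OF F] Lim_Folner[OF G] ..
qed

text \<open>The two nets agree term by term.\<close>

lemma H_top_char_classes:
  fixes \<gamma> :: "'s::monoid_mult \<Rightarrow> 'k::topological_ab_group_add \<Rightarrow> 'k"
  assumes "\<And>s. continuous_endo (\<gamma> s)" "finite X" "add_subgroup X" "left_Folner_net F"
  shows "H_top F \<gamma> (range (char_class X)) = H_alg F (dual_action \<gamma>) X"
  using assms unfolding H_top_def H_alg_def
  by (simp add: min_subcover_card_join_char_classes left_Folner_net_def)

theorem theorem1p2:
  fixes \<gamma> :: "'s::monoid_mult \<Rightarrow> 'k::{topological_ab_group_add, t2_space} \<Rightarrow> 'k"
    and F :: "'i::preorder \<Rightarrow> 's set"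
    and G :: "'j::preorder \<Rightarrow> 's set"
  assumes "cancellative TYPE('s)"
    and "left_amenable TYPE('s)"
    and "compact (UNIV :: 'k set)"
    and "totally_disconnected (UNIV :: 'k set)"
    and "left_action \<gamma>"
    and "\<And>s. continuous_endo (\<gamma> s)"
    and "left_Folner_net F"
    and "left_Folner_net G"
  shows "h_top F \<gamma> = h_alg G (dual_action \<gamma>)"
proof -
  note canc = assms(1) and comp = assms(3) and td = assms(4) and act = assms(5)
    and endo = assms(6) and F = assms(7) and G = assms(8)
  have cont: "continuous_on UNIV (\<gamma> s)" for s
    using endo by (simp add: continuous_endo_def)
  have act': "right_action (dual_action \<gamma>)"
    by (rule right_action_dual_action[OF act endo])
  have add: "Modules.additive (dual_action \<gamma> s)" for s
    by (rule additive_dual_action[OF endo])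
  \<comment> \<open>The termwise comparison is made along \<open>F\<close>; the algebraic side is
    then moved to \<open>G\<close>.\<close>
  have duality: "H_top F \<gamma> (range (char_class X)) = H_alg G (dual_action \<gamma>) X"
    if X: "finite X" "add_subgroup X" for X
  proof -
    have "X \<noteq> {}" using X(2) by (auto simp: add_subgroup_def)
    then show ?thesis
      using H_top_char_classes[OF endo X F]
        H_alg_independent_of_net[OF canc act' add X(1) _ F G] by simp
  qed
  show ?thesis
    unfolding h_top_def h_alg_def
  proof (rule antisym)
    show "(SUP \<U>\<in>{\<U>. open_cover \<U>}. ereal (H_top F \<gamma> \<U>))
        \<le> (SUP X\<in>{X. finite X \<and> X \<noteq> {}}. ereal (H_alg G (dual_action \<gamma>) X))"
    proof (rule SUP_least)
      fix \<U> :: "'k set set" assume "\<U> \<in> {\<U>. open_cover \<U>}"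
      then have \<U>: "open_cover \<U>" by simp
      obtain V where V: "open V" "add_subgroup V" "\<And>x. \<exists>U\<in>\<U>. {y. y - x \<in> V} \<subseteq> U"
        using exists_Lebesgue_subgroup[OF comp td \<U>] by metis
      \<comment> \<open>Its classes lie in cosets of \<open>V\<close>, so they refine
        \<open>\<U>\<close>.\<close>
      let ?X = "annihilator V"
      have X: "finite ?X" "add_subgroup ?X"
        using finite_annihilator[OF comp V(1,2)] add_subgroup_annihilator by auto
      have "\<exists>U\<in>\<U>. W \<subseteq> U" if W: "W \<in> range (char_class ?X)" for W
      proof -
        obtain x where "W = char_class ?X x" using W by (rule rangeE)
        then have "W \<subseteq> {y. y - x \<in> V}"
          using char_class_annihilator_subset[OF comp V(1,2)] by simp
        then show ?thesis using V(3)[of x] by blast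
      qed
      then have "H_top F \<gamma> \<U> \<le> H_top F \<gamma> (range (char_class ?X))"
        by (rule H_top_mono[OF canc comp cont act F \<U> open_cover_char_classes[OF X]])
      also have "\<dots> = H_alg G (dual_action \<gamma>) ?X" by (rule duality[OF X])
      finally have "ereal (H_top F \<gamma> \<U>) \<le> ereal (H_alg G (dual_action \<gamma>) ?X)" by simp
      also have "\<dots> \<le> (SUP X\<in>{X. finite X \<and> X \<noteq> {}}. ereal (H_alg G (dual_action \<gamma>) X))"
        using X by (intro SUP_upper) (auto simp: add_subgroup_def)
      finally show "ereal (H_top F \<gamma> \<U>)
          \<le> (SUP X\<in>{X. finite X \<and> X \<noteq> {}}. ereal (H_alg G (dual_action \<gamma>) X))" .
    qed
    show "(SUP X\<in>{X. finite X \<and> X \<noteq> {}}. ereal (H_alg G (dual_action \<gamma>) X))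
        \<le> (SUP \<U>\<in>{\<U>. open_cover \<U>}. ereal (H_top F \<gamma> \<U>))"
    proof (rule SUP_least)
      fix X :: "'k dual set" assume "X \<in> {X. finite X \<and> X \<noteq> {}}"
      then have X: "finite X" "X \<noteq> {}" by auto
      obtain V where V: "open V" "add_subgroup V" "X \<subseteq> annihilator V"
        using exists_annihilator_superset[OF comp td X(1)] by metis
      \<comment> \<open>Enlarging \<open>X\<close> to a finite group can only raise the entropy and
        makes \<open>duality\<close> applicable.\<close>
      let ?Y = "annihilator V"
      have Y: "finite ?Y" "add_subgroup ?Y"
        using finite_annihilator[OF comp V(1,2)] add_subgroup_annihilator by auto
      have "H_alg G (dual_action \<gamma>) X \<le> H_alg G (dual_action \<gamma>) ?Y"
        by (rule H_alg_mono[OF canc act' add G X(2) V(3) Y(1)])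
      also have "\<dots> = H_top F \<gamma> (range (char_class ?Y))" by (rule duality[OF Y, symmetric])
      finally have "ereal (H_alg G (dual_action \<gamma>) X) \<le> ereal (H_top F \<gamma> (range (char_class ?Y)))" by simp
      also have "\<dots> \<le> (SUP \<U>\<in>{\<U>. open_cover \<U>}. ereal (H_top F \<gamma> \<U>))"
        using open_cover_char_classes[OF Y] by (intro SUP_upper) simp
      finally show "ereal (H_alg G (dual_action \<gamma>) X)
          \<le> (SUP \<U>\<in>{\<U>. open_cover \<U>}. ereal (H_top F \<gamma> \<U>))" .
    qed
  qed
qed

end
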